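(* Let $a$ be a positive integer and $b$ an integer with $b>-a$ and $\gcd(a,b)=1$. Let $n\in\mathbb{N}$ be such that $ab$ is even or $n$ is even. Suppose that $$\frac n6>66a^2(9a-1)+a+(33a-1)b+(2a(18a-1)+b)\sqrt{15(2a(9a-1)+b)}.$$ Then there are $w,x,y,z\in\mathbb{N}$ such that $$3w(aw+b)+x(ax+b)+y(ay+b)+z(az+b)=n.$$
   Context: $\mathbb{N}=\{0,1,2,\ldots\}$. *)

theory Defs
  imports Complex_Main
begin

end

(* With A = 3w^2 + x^2 + y^2 + z^2 and B = 3w + x + y + z the equation reads n = aA + bB, and
   6A - B^2 = u^2 + v^2 + 3t^2 where u = (x - w) + (y - w) + (z - w), v = 3(x - w) - u, t = y - z.
   Conversely, when A and B have the same parity, a representation of 6A - B^2 by u^2 + v^2 + 3t^2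
   yields integers w, x, y, z, which are nonnegative once 5(6A - B^2) < (B + 6)^2.
   The bound on n leaves a window for B containing six consecutive members of its class modulo a,
   enough to reach D = 6A - B^2 with D = 2 (mod 3) or D = 3 (mod 9).

   Such a D is represented by u^2 + v^2 + 3t^2: take a positive ternary form of determinant 3 which
   represents D and some q = 5 (mod 8); reduction leaves only u^2 + v^2 + 3t^2 and
   u^2 + 2v^2 + 2vw + 2w^2, and the latter never takes values 5 (mod 8).
   The form exists if q lies in a suitable class and -3D is a square modulo every prime factor of q.
   Dirichlet's theorem would give a prime q, but a product of primes suffices: if the primes p with
   chi(p) = 1 did not generate the kernel of the real character chi modulo squares, some real
   character psi would be trivial on them but not on ker chi. Then psi * (1 * chi) = 1 * chi
   (Dirichlet convolution on n prime to the modulus) is nonnegative and at least 1 on squares, so its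
   sum weighted by n^(-1/2) diverges, while the hyperbola method bounds the same sum for the
   convolution of the two nonprincipal characters psi and chi psi. *)

theory Submission
  imports Defs "HOL-Number_Theory.Number_Theory" "HOL-Computational_Algebra.Squarefree"
begin

section \<open>Real characters, partial summation and the hyperbola method\<close>

section \<open>Sums of real characters\<close>

text \<open>A real Dirichlet character modulo \<open>M\<close>, possibly imprimitive. The principal
  character is included, so nonprincipality is always expressed by some \<open>c\<close> with value
  -1.\<close>

definition rchar :: "nat \<Rightarrow> (nat \<Rightarrow> int) \<Rightarrow> bool" where
  "rchar M f \<longleftrightarrow> M > 0 \<and> (\<forall>m n. f (m * n) = f m * f n) \<and> (\<forall>m n. [m = n] (mod M) \<longrightarrow> f m = f n)
     \<and> (\<forall>m. f m \<in> {- 1, 0, 1}) \<and> (\<forall>m. f m \<noteq> 0 \<longleftrightarrow> coprime m M)"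

lemma rcharD:
  assumes "rchar M f"
  shows rchar_pos: "M > 0"
    and rchar_mult: "f (m * n) = f m * f n"
    and rchar_cong: "[m = n] (mod M) \<Longrightarrow> f m = f n"
    and rchar_vals: "f m = - 1 \<or> f m = 0 \<or> f m = 1"
    and rchar_nonzero_iff: "f m \<noteq> 0 \<longleftrightarrow> coprime m M"
  using assms unfolding rchar_def by blast+

lemma rchar_1: "rchar M f \<Longrightarrow> f 1 = 1"
  using rchar_mult[of M f 1 1] rchar_nonzero_iff[of M f 1] by auto

lemma rchar_power: "rchar M f \<Longrightarrow> f (m ^ k) = f m ^ k"
  by (induction k) (simp_all add: rchar_1[simplified] rchar_mult)

lemma rchar_times:
  assumes f: "rchar M f" and g: "rchar M g"
  shows "rchar M (\<lambda>m. f m * g m)"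
  unfolding rchar_def
proof (intro conjI allI impI)
  fix m n :: nat
  show "f (m * n) * g (m * n) = f m * g m * (f n * g n)"
    by (simp add: rchar_mult[OF f] rchar_mult[OF g])
  show "f m * g m \<in> {- 1, 0, 1}" using rchar_vals[OF f, of m] rchar_vals[OF g, of m] by auto
  show "f m * g m \<noteq> 0 \<longleftrightarrow> coprime m M"
    using rchar_nonzero_iff[OF f, of m] rchar_nonzero_iff[OF g, of m] by auto
  assume "[m = n] (mod M)"
  then show "f m * g m = f n * g n" using rchar_cong[OF f] rchar_cong[OF g] by metis
qed (rule rchar_pos[OF f])

text \<open>Multiplication by \<open>c\<close> permutes the residues modulo \<open>M\<close> and
  changes the sign of every value, so the sum over a period equals its own negative.\<close>

lemma sum_block_rchar:
  assumes "rchar M f" "f c = - 1"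
  shows "(\<Sum>i\<in>{a..<a+M}. f i) = 0"
proof -
  have M: "M > 0" using assms rchar_pos by blast
  have c: "coprime c M" using assms rchar_nonzero_iff by force
  \<comment> \<open>By periodicity the starting point of the block does not matter.\<close>
  have shift: "(\<Sum>i\<in>{a..<a+M}. f i) = (\<Sum>i<M. f i)" for a
  proof (induction a)
    case 0
    show ?case by (simp add: lessThan_atLeast0)
  next
    case (Suc a)
    have "(\<Sum>i\<in>{Suc a..<Suc a+M}. f i) + f a = (\<Sum>i\<in>{a..<a+M}. f i) + f (a+M)"
      using M sum.atLeast_Suc_lessThan[of a "a+M" f] by simp
    moreover have "f (a + M) = f a" by (rule rchar_cong[OF assms(1)]) (simp add: cong_def)
    ultimately show ?case using Suc by simp
  qed
  have "bij_betw (\<lambda>x. x * c mod M) {..<M} {..<M}"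
    unfolding bij_betw_def
  proof
    show inj: "inj_on (\<lambda>x. x * c mod M) {..<M}"
      by (rule inj_onI) (metis c cong_def cong_less_modulus_unique_nat cong_mult_rcancel_nat lessThan_iff)
    show "(\<lambda>x. x * c mod M) ` {..<M} = {..<M}"
      by (rule card_subset_eq) (auto simp: M card_image[OF inj])
  qed
  then have "(\<Sum>i<M. f i) = (\<Sum>i<M. f (i * c mod M))"
    by (simp add: sum.reindex_bij_betw[where g = f])
  also have "\<dots> = (\<Sum>i<M. - f i)"
  proof (rule sum.cong)
    fix x
    have "f (x * c mod M) = f (x * c)" by (rule rchar_cong[OF assms(1)]) (simp add: cong_def)
    then show "f (x * c mod M) = - f x" using rchar_mult[OF assms(1)] assms(2) by simp
  qed simp
  finally show ?thesis using shift by (simp add: sum_negf)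
qed

text \<open>Complete blocks contribute 0; fewer than \<open>M\<close> terms of absolute value at
  most 1 remain.\<close>

lemma abs_sum_rchar_le:
  assumes "rchar M f" "f c = - 1"
  shows "\<bar>\<Sum>i\<in>{a..<b}. f i\<bar> \<le> M"
proof (induction "b - a" arbitrary: a rule: less_induct)
  case less
  have M: "M > 0" using assms rchar_pos by blast
  show ?case
  proof (cases "b - a < M")
    case True
    have "\<bar>\<Sum>i\<in>{a..<b}. f i\<bar> \<le> (\<Sum>i\<in>{a..<b}. \<bar>f i\<bar>)" by (rule sum_abs)
    also have "\<dots> \<le> (\<Sum>i\<in>{a..<b}. 1)"
    proof (rule sum_mono)
      fix i show "\<bar>f i\<bar> \<le> 1" using rchar_vals[OF assms(1), of i] by auto
    qed
    finally show ?thesis using True by simp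
  next
    case False
    then have "(\<Sum>i\<in>{a..<b}. f i) = (\<Sum>i\<in>{a..<a+M}. f i) + (\<Sum>i\<in>{a+M..<b}. f i)"
      using M by (subst sum.atLeastLessThan_concat) auto
    then show ?thesis using less[of "a+M"] M False sum_block_rchar[OF assms] by simp
  qed
qed

text \<open>Summation by parts: the partial sums \<open>F\<close> are bounded by \<open>B\<close>,
  the differences of \<open>g\<close> are nonnegative, and their sum telescopes to
  \<open>g 0 - g n\<close>.\<close>

lemma abel_sum_bound:
  fixes f g :: "nat \<Rightarrow> real"
  assumes F: "\<And>j. \<bar>\<Sum>k<j. f k\<bar> \<le> B" and g: "\<And>k. g (Suc k) \<le> g k" "\<And>k. 0 \<le> g k"
  shows "\<bar>\<Sum>k<n. f k * g k\<bar> \<le> B * g 0"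
proof -
  define F where "F j = (\<Sum>k<j. f k)" for j
  have F': "\<bar>F j\<bar> \<le> B" for j unfolding F_def by (rule assms)
  have "(\<Sum>k<n. f k * g k) = F n * g n + (\<Sum>k<n. F (Suc k) * (g k - g (Suc k)))"
    by (induction n) (simp_all add: F_def algebra_simps)
  moreover have "\<bar>F n * g n\<bar> \<le> B * g n" using F' g by (simp add: abs_mult mult_right_mono)
  moreover have "\<bar>\<Sum>k<n. F (Suc k) * (g k - g (Suc k))\<bar> \<le> B * (g 0 - g n)"
  proof -
    have "\<bar>\<Sum>k<n. F (Suc k) * (g k - g (Suc k))\<bar> \<le> (\<Sum>k<n. \<bar>F (Suc k) * (g k - g (Suc k))\<bar>)" by (rule sum_abs)
    also have "\<dots> \<le> (\<Sum>k<n. B * (g k - g (Suc k)))"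
      by (rule sum_mono) (use F' g in \<open>auto simp: abs_mult intro!: mult_right_mono\<close>)
    also have "\<dots> = B * (g 0 - g n)" by (simp add: sum_lessThan_telescope' flip: sum_distrib_left)
    finally show ?thesis .
  qed
  ultimately show ?thesis by (simp add: algebra_simps)
qed

text \<open>Partial summation makes the bound uniform in \<open>b\<close> and decaying in
  \<open>a\<close>; this decay controls the long inner sums in the hyperbola method.\<close>

lemma abs_sum_rchar_sqrt_le:
  assumes "rchar M f" "f c = - 1"
  shows "\<bar>\<Sum>i\<in>{a<..b}. f i / sqrt i\<bar> \<le> M / sqrt (Suc a)"
proof -
  define n where "n = b - a"
  have "(\<Sum>i\<in>{a<..b}. f i / sqrt i) = (\<Sum>k<n. real_of_int (f (Suc a + k)) * (1 / sqrt (Suc a + k)))"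
    by (rule sum.reindex_bij_witness[of _ "\<lambda>k. Suc a + k" "\<lambda>i. i - Suc a"]) (auto simp: n_def)
  moreover have "\<bar>\<Sum>k<n. real_of_int (f (Suc a + k)) * (1 / sqrt (Suc a + k))\<bar> \<le> M * (1 / sqrt (Suc a + 0))"
  proof (rule abel_sum_bound)
    fix j
    have "(\<Sum>k<j. f (Suc a + k)) = (\<Sum>i\<in>{Suc a..<Suc a + j}. f i)"
      by (rule sum.reindex_bij_witness[of _ "\<lambda>i. i - Suc a" "\<lambda>k. Suc a + k" ]) auto
    then have "\<bar>\<Sum>k<j. f (Suc a + k)\<bar> \<le> M" using abs_sum_rchar_le[OF assms] by metis
    then show "\<bar>\<Sum>k<j. real_of_int (f (Suc a + k))\<bar> \<le> M" by (metis of_int_abs of_int_le_iff of_int_of_nat_eq of_int_sum)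
  qed (auto intro!: divide_left_mono)
  ultimately show ?thesis by simp
qed

lemma sum_inverse_sqrt_le:
  fixes n :: nat
  shows "(\<Sum>i\<in>{0<..n}. 1 / sqrt (real i)) \<le> 2 * sqrt n"
proof (induction n)
  case 0
  show ?case by simp
next
  case (Suc n)
  have "2 * sqrt n + 1 / sqrt (Suc n) \<le> 2 * sqrt (Suc n)"
  proof -
    define x y where "x = sqrt n" and "y = sqrt (Suc n)"
    have "y > 0" "y * y = x * x + 1" unfolding x_def y_def by auto
    \<comment> \<open>Expanding the square with \<open>y * y = x * x + 1\<close> gives exactly the
      inequality needed.\<close>
    moreover have "0 \<le> (y - x)\<^sup>2" by simp
    ultimately have "2 * x * y + 1 \<le> 2 * y * y" by (simp add: power2_eq_square algebra_simps)
    then have "2 * x + 1 / y \<le> 2 * y" using \<open>y > 0\<close> by (simp add: field_simps)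
    then show ?thesis unfolding x_def y_def .
  qed
  moreover have "{0<..Suc n} = insert (Suc n) {0<..n}" by auto
  ultimately show ?case using Suc by simp
qed

text \<open>The pairs under the hyperbola split into those with both entries at most
  \<open>K\<close> and those with exactly one entry above \<open>K\<close>; two entries above
  \<open>K\<close> would have a product above the square of \<open>K\<close>.\<close>

lemma hyperbola_split:
  fixes h :: "nat \<Rightarrow> nat \<Rightarrow> real"
  shows "(\<Sum>(d,e) | d > 0 \<and> e > 0 \<and> d * e \<le> K\<^sup>2. h d e) =
    (\<Sum>d\<in>{0<..K}. \<Sum>e\<in>{0<..K}. h d e) + (\<Sum>d\<in>{0<..K}. \<Sum>e\<in>{K<..K\<^sup>2 div d}. h d e)
    + (\<Sum>e\<in>{0<..K}. \<Sum>d\<in>{K<..K\<^sup>2 div e}. h d e)"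
proof -
  define S1 where "S1 = {0<..K} \<times> {0<..K}"
  define S2 where "S2 = (SIGMA d:{0<..K}. {K<..K\<^sup>2 div d})"
  define S3 where "S3 = prod.swap ` (SIGMA e:{0<..K}. {K<..K\<^sup>2 div e})"
  have "{(d,e). d > 0 \<and> e > 0 \<and> d * e \<le> K\<^sup>2} = S1 \<union> S2 \<union> S3"
  proof (intro equalityI subsetI; clarify)
    fix d e :: nat assume *: "0 < d" "0 < e" "d * e \<le> K\<^sup>2"
    have "d \<le> K \<or> e \<le> K"
    proof (rule ccontr)
      assume "\<not> (d \<le> K \<or> e \<le> K)"
      then have "K * K < d * e" by (intro mult_strict_mono) auto
      then show False using * by (simp add: power2_eq_square)
    qed
    moreover have "d \<le> K\<^sup>2 div e" "e \<le> K\<^sup>2 div d"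
      using * by (simp_all add: less_eq_div_iff_mult_less_eq mult.commute)
    moreover assume "(d, e) \<notin> S3" "(d, e) \<notin> S2"
    ultimately show "(d, e) \<in> S1"
      using * unfolding S1_def S2_def S3_def by (auto simp: image_iff)
  next
    fix d e :: nat assume *: "(d,e) \<in> S1 \<union> S2 \<union> S3"
    then have "0 < d \<and> 0 < e" unfolding S1_def S2_def S3_def by auto
    moreover have "d * e \<le> K\<^sup>2"
      using * unfolding S1_def S2_def S3_def
      by (auto simp: power2_eq_square mult_mono less_eq_div_iff_mult_less_eq mult.commute)
    ultimately show "0 < d \<and> 0 < e \<and> d * e \<le> K\<^sup>2" by blast
  qed
  then have "(\<Sum>(d,e) | d > 0 \<and> e > 0 \<and> d * e \<le> K\<^sup>2. h d e) = (\<Sum>(d,e)\<in>S1 \<union> S2 \<union> S3. h d e)" by simp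
  also have "\<dots> = (\<Sum>(d,e)\<in>S1. h d e) + (\<Sum>(d,e)\<in>S2. h d e) + (\<Sum>(d,e)\<in>S3. h d e)"
    by (subst sum.union_disjoint, auto simp: S1_def S2_def S3_def)+
  also have "(\<Sum>(d,e)\<in>S3. h d e) = (\<Sum>e\<in>{0<..K}. \<Sum>d\<in>{K<..K\<^sup>2 div e}. h d e)"
    unfolding S3_def by (subst sum.reindex) (auto simp: sum.Sigma intro!: sum.cong)
  finally show ?thesis unfolding S1_def S2_def by (simp add: sum.Sigma sum.cartesian_product)
qed

lemma mult_le_abs_mult: "x * y \<le> \<bar>x\<bar> * \<bar>y\<bar>" for x y :: real
  by (simp flip: abs_mult)

text \<open>The square part is a product of two bounded character sums. In each remaining part the
  outer sum is at most 2 sqrt(K) and the inner one at most M / sqrt(K + 1), so \<open>K\<close>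
  cancels from the bound.\<close>

lemma hyperbola_bound:
  assumes "rchar M f" "f c = - 1" "rchar M g" "g c' = - 1"
  shows "(\<Sum>(d,e) | d > 0 \<and> e > 0 \<and> d * e \<le> K\<^sup>2. (f d / sqrt d) * (g e / sqrt e)) \<le> M * M + 4 * M"
proof -
  \<comment> \<open>Stated for arbitrary characters, because it is applied a second time with the
    roles of \<open>f\<close> and \<open>g\<close> exchanged.\<close>
  have tail: "(\<Sum>d\<in>{0<..K}. \<Sum>e\<in>{K<..K\<^sup>2 div d}. (f d / sqrt d) * (g e / sqrt e)) \<le> 2 * M"
    if "rchar M f" "rchar M g" "g c = - 1" for f g c
  proof -
    have "(\<Sum>d\<in>{0<..K}. \<Sum>e\<in>{K<..K\<^sup>2 div d}. (f d / sqrt d) * (g e / sqrt e))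
        = (\<Sum>d\<in>{0<..K}. (f d / sqrt d) * (\<Sum>e\<in>{K<..K\<^sup>2 div d}. g e / sqrt e))"
      by (simp add: sum_distrib_left)
    also have "\<dots> \<le> (\<Sum>d\<in>{0<..K}. (1 / sqrt d) * (M / sqrt (Suc K)))"
    proof (rule sum_mono)
      fix d assume "d \<in> {0<..K}"
      have "(f d / sqrt d) * (\<Sum>e\<in>{K<..K\<^sup>2 div d}. g e / sqrt e)
          \<le> \<bar>f d / sqrt d\<bar> * \<bar>\<Sum>e\<in>{K<..K\<^sup>2 div d}. g e / sqrt e\<bar>"
        by (rule mult_le_abs_mult)
      also have "\<dots> \<le> (1 / sqrt d) * (M / sqrt (Suc K))"
      proof (rule mult_mono)
        show "\<bar>f d / sqrt d\<bar> \<le> 1 / sqrt d"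
          using rchar_vals[OF that(1), of d] by (auto simp: abs_div)
      qed (use abs_sum_rchar_sqrt_le[OF that(2,3)] in auto)
      finally show "(f d / sqrt d) * (\<Sum>e\<in>{K<..K\<^sup>2 div d}. g e / sqrt e)
          \<le> (1 / sqrt d) * (M / sqrt (Suc K))" .
    qed
    also have "\<dots> = (\<Sum>d\<in>{0<..K}. 1 / sqrt d) * (M / sqrt (Suc K))" by (rule sum_distrib_right[symmetric])
    also have "\<dots> \<le> 2 * sqrt (Suc K) * (M / sqrt (Suc K))"
    proof (rule mult_right_mono)
      have "sqrt K \<le> sqrt (Suc K)" by simp
      then show "(\<Sum>d\<in>{0<..K}. 1 / sqrt d) \<le> 2 * sqrt (Suc K)"
        using sum_inverse_sqrt_le[of K] by linarith
    qed simp
    finally show ?thesis by simp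
  qed
  have head: "(\<Sum>d\<in>{0<..K}. \<Sum>e\<in>{0<..K}. (f d / sqrt d) * (g e / sqrt e)) \<le> M * M"
  proof -
    have "(\<Sum>d\<in>{0<..K}. \<Sum>e\<in>{0<..K}. (f d / sqrt d) * (g e / sqrt e))
        = (\<Sum>d\<in>{0<..K}. f d / sqrt d) * (\<Sum>e\<in>{0<..K}. g e / sqrt e)"
      by (simp add: sum_product)
    also have "\<dots> \<le> \<bar>\<Sum>d\<in>{0<..K}. f d / sqrt d\<bar> * \<bar>\<Sum>e\<in>{0<..K}. g e / sqrt e\<bar>"
      by (rule mult_le_abs_mult)
    also have "\<dots> \<le> real M * M"
      using abs_sum_rchar_sqrt_le[OF assms(1,2), of 0 K] abs_sum_rchar_sqrt_le[OF assms(3,4), of 0 K]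
      by (intro mult_mono) auto
    finally show ?thesis by simp
  qed
  have "(\<Sum>e\<in>{0<..K}. \<Sum>d\<in>{K<..K\<^sup>2 div e}. (f d / sqrt d) * (g e / sqrt e)) \<le> 2 * M"
    using tail[OF assms(3,1,2)] by (simp add: mult.commute)
  then show ?thesis using head tail[OF assms(1,3,4)]
    by (subst hyperbola_split) simp
qed

text \<open>Every divisor of \<open>p ^ k * m\<close> is uniquely \<open>p ^ i * d\<close> with
  \<open>i\<close> at most \<open>k\<close> and \<open>d\<close> dividing \<open>m\<close>. At
  \<open>i = 0\<close> the hypothesis \<open>pow\<close> supplies \<open>f 1 = 1\<close>, which the
  zero function shows is not a consequence of \<open>mult\<close>.\<close>

lemma sum_divisors_prime_power_mult:
  fixes f :: "nat \<Rightarrow> int"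
  assumes mult: "\<And>m n. f (m * n) = f m * f n" and pow: "\<And>i. f (p ^ i) = f p ^ i"
    and p: "prime p" "\<not> p dvd m"
  shows "(\<Sum>d | d dvd p ^ k * m. f d) = (\<Sum>i\<le>k. f p ^ i) * (\<Sum>d | d dvd m. f d)"
proof -
  have m: "m > 0" using p(2) by (cases m) auto
  let ?h = "\<lambda>(i, d). p ^ i * d"
  have "inj_on ?h ({..k} \<times> {d. d dvd m})"
  proof (rule inj_onI; clarify)
    fix i d j e assume *: "d dvd m" "e dvd m" "p ^ i * d = p ^ j * e"
    have "multiplicity p (p ^ i * d) = i" if "d dvd m" for i d
    proof -
      have "\<not> p dvd d" "d > 0" using that p(2) m by (auto intro: dvd_trans dest: dvd_pos_nat)
      then show ?thesis using p(1)
        by (simp add: prime_elem_multiplicity_mult_distrib multiplicity_same_power not_dvd_imp_multiplicity_0)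
    qed
    then have "i = j" using * by metis
    then show "i = j \<and> d = e" using * p(1) by auto
  qed
  moreover have "?h ` ({..k} \<times> {d. d dvd m}) = {d. d dvd p ^ k * m}"
  proof (intro equalityI subsetI)
    fix x assume "x \<in> {d. d dvd p ^ k * m}"
    then obtain b c where bc: "x = b * c" "b dvd p ^ k" "c dvd m"
      using division_decomp by blast
    then obtain i where "i \<le> k" "b = p ^ i" using divides_primepow_nat p(1) by blast
    then show "x \<in> ?h ` ({..k} \<times> {d. d dvd m})" using bc by force
  qed (auto intro!: mult_dvd_mono le_imp_power_dvd)
  ultimately have "(\<Sum>d | d dvd p ^ k * m. f d) = (\<Sum>(i,d)\<in>{..k} \<times> {d. d dvd m}. f (p ^ i * d))"
    by (intro sum.reindex_cong) auto
  also have "\<dots> = (\<Sum>i\<le>k. \<Sum>d | d dvd m. f p ^ i * f d)"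
    by (subst sum.cartesian_product[symmetric]) (simp add: mult pow)
  finally show ?thesis by (simp add: sum_product)
qed

text \<open>Removes the full power of one prime: the induction step for multiplicative
  functions.\<close>

lemma nat_prime_power_cases:
  assumes "n > (1::nat)"
  obtains p k m where "prime p" "k > 0" "n = p ^ k * m" "\<not> p dvd m" "m < n" "m > 0"
proof -
  obtain p where p: "prime p" "p dvd n" using assms prime_factor_nat by (metis less_irrefl)
  obtain m where m: "n = p ^ multiplicity p n * m" "\<not> p dvd m"
    using assms p(1) multiplicity_decompose'[of n p] by (metis gr_implies_not0 mult.commute not_prime_unit)
  have k: "multiplicity p n > 0" using p assms by (simp add: prime_multiplicity_gt_zero_iff)
  have "m > 0" using m(2) by (cases m) auto
  moreover have "1 < p ^ multiplicity p n" using k prime_gt_1_nat[OF p(1)] by (rule one_less_power[rotated])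
  ultimately have "1 * m < p ^ multiplicity p n * m" by (rule mult_strict_right_mono[rotated])
  then have "m < n" using m(1) by linarith
  then show ?thesis by (rule that[OF p(1) k m _ \<open>m > 0\<close>])
qed


section \<open>A nonnegative convolution of two nonprincipal characters, and the contradiction it
  yields\<close>

lemma alternating_sum: "(\<Sum>i\<le>k. (- 1 :: int) ^ i) = (if even k then 1 else 0)"
  by (induction k) auto

text \<open>A hypothetical situation, refuted by \<open>inconsistent\<close>. The element
  \<open>c\<close> shows that both \<open>\<psi>\<close> and the product of \<open>\<chi>\<close>
  and \<open>\<psi>\<close> are nonprincipal.\<close>

locale char_pair =
  fixes M :: nat and \<chi> \<psi> :: "nat \<Rightarrow> int" and c :: nat
  assumes \<chi>: "rchar M \<chi>" and \<psi>: "rchar M \<psi>"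
    and c: "\<chi> c = 1" "\<psi> c = - 1"
    and split: "\<And>p. prime p \<Longrightarrow> \<chi> p = 1 \<Longrightarrow> \<psi> p = 1"
begin

text \<open>The pointwise product of \<open>\<psi>\<close> with the convolution 1 *
  \<open>\<chi>\<close>. This shape gives positivity; \<open>g_convolution\<close> gives the other
  shape, which the hyperbola method bounds.\<close>

definition g :: "nat \<Rightarrow> int" where "g n = \<psi> n * (\<Sum>d | d dvd n. \<chi> d)"

lemma g_prime_power_mult:
  assumes "prime p" "\<not> p dvd m"
  shows "g (p ^ k * m) = (\<psi> p ^ k * (\<Sum>i\<le>k. \<chi> p ^ i)) * g m"
  unfolding g_def
  by (subst sum_divisors_prime_power_mult[OF rchar_mult[OF \<chi>] rchar_power[OF \<chi>] assms])
     (simp add: rchar_mult[OF \<psi>] rchar_power[OF \<psi>])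

text \<open>If \<open>\<chi> p = 1\<close> then \<open>\<psi> p = 1\<close> by \<open>split\<close>
  and the factor is k + 1. If \<open>\<chi> p = - 1\<close> the sum alternates: it is 0 for odd
  \<open>k\<close> and 1 for even \<open>k\<close>, where the sign of \<open>\<psi> p\<close> also
  disappears.\<close>

lemma local_factor:
  assumes "prime p" "coprime p M"
  shows "0 \<le> \<psi> p ^ k * (\<Sum>i\<le>k. \<chi> p ^ i)"
    and "even k \<Longrightarrow> 1 \<le> \<psi> p ^ k * (\<Sum>i\<le>k. \<chi> p ^ i)"
proof -
  have "\<chi> p = 1 \<or> \<chi> p = - 1" "\<psi> p = 1 \<or> \<psi> p = - 1"
    using rchar_vals[OF \<chi>, of p] rchar_nonzero_iff[OF \<chi>, of p]
      rchar_vals[OF \<psi>, of p] rchar_nonzero_iff[OF \<psi>, of p] assms(2) by auto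
  then show "0 \<le> \<psi> p ^ k * (\<Sum>i\<le>k. \<chi> p ^ i)" "even k \<Longrightarrow> 1 \<le> \<psi> p ^ k * (\<Sum>i\<le>k. \<chi> p ^ i)"
    using split[OF assms(1)] by (auto simp: alternating_sum)
qed

lemma g_nonneg: "0 \<le> g n"
proof (cases "n > 0 \<and> coprime n M")
  case True
  then show ?thesis
  proof (induction n rule: less_induct)
    case (less n)
    show ?case
    proof (cases "n > 1")
      case True
      then obtain p k m where pkm: "prime p" "k > 0" "n = p ^ k * m" "\<not> p dvd m" "m < n" "m > 0"
        by (rule nat_prime_power_cases)
      then have "coprime p M" "coprime m M" using less.prems by auto
      then show ?thesis
        using less.IH[of m] g_prime_power_mult[OF pkm(1,4)] local_factor(1)[OF pkm(1)] pkm by simp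
    next
      case False
      then have "n = 1" using less.prems by auto
      then show ?thesis using rchar_1[OF \<chi>] rchar_1[OF \<psi>] by (simp add: g_def)
    qed
  qed
next
  case False
  show ?thesis
  proof (cases "n = 0")
    case True
    \<comment> \<open>Every number divides 0, and a sum over an infinite set is 0 by
      default.\<close>
    then show ?thesis using True by (simp add: g_def)
  next
    case 2: False
    then have "\<psi> n = 0" using False rchar_nonzero_iff[OF \<psi>] by blast
    then show ?thesis by (simp add: g_def)
  qed
qed

text \<open>All exponents in a square are even, so every local factor is at least 1.\<close>

lemma g_square: "n > 0 \<Longrightarrow> coprime n M \<Longrightarrow> 1 \<le> g (n\<^sup>2)"
proof (induction n rule: less_induct)
  case (less n)
  show ?case
  proof (cases "n > 1")
    case True
    then obtain p k m where pkm: "prime p" "k > 0" "n = p ^ k * m" "\<not> p dvd m" "m < n" "m > 0"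
      by (rule nat_prime_power_cases)
    then have cop: "coprime p M" "coprime m M" using less.prems by auto
    have "n\<^sup>2 = p ^ (2 * k) * m\<^sup>2" by (simp add: pkm(3) power_mult_distrib power_mult mult.commute flip: power_mult)
    moreover have "\<not> p dvd m\<^sup>2" using pkm prime_dvd_power by blast
    ultimately have "g (n\<^sup>2) = (\<psi> p ^ (2 * k) * (\<Sum>i\<le>2 * k. \<chi> p ^ i)) * g (m\<^sup>2)"
      using g_prime_power_mult[OF pkm(1)] by metis
    moreover have "1 \<le> \<psi> p ^ (2 * k) * (\<Sum>i\<le>2 * k. \<chi> p ^ i)" using local_factor(2)[OF pkm(1) cop(1), of "2 * k"] by simp
    moreover have "1 \<le> g (m\<^sup>2)" using less.IH pkm cop by blast
    ultimately show ?thesis using mult_mono[of 1 _ 1 "g (m\<^sup>2)"] by simp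
  next
    case False
    then have "n = 1" using less.prems by auto
    then show ?thesis using rchar_1[OF \<chi>] rchar_1[OF \<psi>] by (simp add: g_def)
  qed
qed

lemma g_convolution: "n > 0 \<Longrightarrow> g n = (\<Sum>d | d dvd n. (\<chi> d * \<psi> d) * \<psi> (n div d))"
proof -
  assume "n > 0"
  have "g n = (\<Sum>d | d dvd n. \<psi> n * \<chi> d)" by (simp add: g_def sum_distrib_left)
  also have "\<dots> = (\<Sum>d | d dvd n. (\<chi> d * \<psi> d) * \<psi> (n div d))"
  proof (rule sum.cong)
    fix d assume "d \<in> {d. d dvd n}"
    then have "\<psi> n = \<psi> d * \<psi> (n div d)" by (simp flip: rchar_mult[OF \<psi>])
    then show "\<psi> n * \<chi> d = (\<chi> d * \<psi> d) * \<psi> (n div d)" by simp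
  qed simp
  finally show ?thesis .
qed

text \<open>Sorting by the divisor turns the sum over \<open>n\<close> into a sum over lattice
  points under a hyperbola, with two nonprincipal characters as weights.\<close>

lemma sum_g_upper: "(\<Sum>n\<in>{0<..K\<^sup>2}. g n / sqrt n) \<le> real M * M + 4 * M"
proof -
  let ?\<phi> = "\<lambda>m. \<chi> m * \<psi> m"
  let ?h = "\<lambda>d e. (?\<phi> d / sqrt d) * (\<psi> e / sqrt e)"
  have "(\<Sum>n\<in>{0<..K\<^sup>2}. g n / sqrt n) = (\<Sum>n\<in>{0<..K\<^sup>2}. \<Sum>d | d dvd n. ?h d (n div d))"
  proof (rule sum.cong)
    fix n assume n: "n \<in> {0<..K\<^sup>2}"
    then have "g n / sqrt n = (\<Sum>d | d dvd n. real_of_int ((\<chi> d * \<psi> d) * \<psi> (n div d)) / sqrt n)"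
      by (subst g_convolution) (simp_all add: sum_divide_distrib)
    also have "\<dots> = (\<Sum>d | d dvd n. ?h d (n div d))"
    proof (rule sum.cong)
      fix d assume "d \<in> {d. d dvd n}"
      then have "sqrt n = sqrt d * sqrt (n div d)" 
        by (metis dvd_mult_div_cancel mem_Collect_eq of_nat_mult real_sqrt_mult)
      then show "real_of_int ((\<chi> d * \<psi> d) * \<psi> (n div d)) / sqrt n = ?h d (n div d)" by simp
    qed simp
    finally show "g n / sqrt n = (\<Sum>d | d dvd n. ?h d (n div d))" .
  qed simp
  also have "\<dots> = (\<Sum>(n,d)\<in>(SIGMA n:{0<..K\<^sup>2}. {d. d dvd n}). ?h d (n div d))"
    by (rule sum.Sigma) auto
  also have "\<dots> = (\<Sum>(d,e) | d > 0 \<and> e > 0 \<and> d * e \<le> K\<^sup>2. ?h d e)"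
    by (rule sum.reindex_bij_witness[of _ "\<lambda>(d,e). (d * e, d)" "\<lambda>(n,d). (d, n div d)"])
       (auto intro!: Nat.gr0I)
  also have "\<dots> \<le> real M * M + 4 * M"
    using hyperbola_bound[OF rchar_times[OF \<chi> \<psi>] _ \<psi>, of c c K] c by simp
  finally show ?thesis .
qed

text \<open>By nonnegativity only the squares of the numbers 1 + jM need be kept. These numbers are
  prime to \<open>M\<close>, so each square contributes at least 1 / (1 + jM).\<close>

lemma sum_g_lower: "(\<Sum>j<K. 1 / (1 + j * M)) \<le> real M * M + 4 * real M"
proof -
  define L where "L = 1 + K * M"
  have M: "M > 0" using \<chi> rchar_pos by blast
  let ?s = "\<lambda>j. (1 + j * M)\<^sup>2"
  have inj: "inj_on ?s {..<K}" using M by (auto intro!: inj_onI simp: power2_eq_iff_nonneg)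
  have "(\<Sum>j<K. 1 / (1 + j * M)) \<le> (\<Sum>j<K. g (?s j) / sqrt (?s j))"
  proof (rule sum_mono)
    fix j
    have "coprime (1 + j * M) M" by (rule coprimeI) (metis dvd_add_left_iff dvd_mult)
    then have "1 \<le> g (?s j)" by (intro g_square) auto
    then have "1 \<le> real_of_int (g (?s j))" by linarith
    then show "1 / (1 + j * M) \<le> g (?s j) / sqrt (?s j)" by (simp del: of_nat_add add: divide_right_mono)
  qed
  also have "\<dots> = (\<Sum>n\<in>?s ` {..<K}. g n / sqrt n)" by (subst sum.reindex[OF inj]) simp
  also have "\<dots> \<le> (\<Sum>n\<in>{0<..L\<^sup>2}. g n / sqrt n)"
    by (rule sum_mono2) (auto simp: L_def g_nonneg intro!: power_mono)
  also have "\<dots> \<le> real M * M + 4 * M" by (rule sum_g_upper)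
  finally show ?thesis by simp
qed

lemma inconsistent: False
proof -
  have M: "M > 0" using \<chi> rchar_pos by blast
  \<comment> \<open>The harmonic series along the progression dominates a logarithm, which outgrows
    the bound of \<open>sum_g_lower\<close>.\<close>
  have *: "ln (1 + real K) \<le> M * (\<Sum>j<K. 1 / (1 + j * M))" for K
  proof (induction K)
    case (Suc K)
    have "ln (1 + real (Suc K)) - ln (1 + real K) = ln (1 + 1 / (1 + real K))"
      by (simp add: field_simps flip: ln_divide_pos)
    also have "\<dots> \<le> 1 / (1 + real K)" by (rule ln_add_one_self_le_self) simp
    also have "\<dots> \<le> M * (1 / (1 + K * M))"
    proof -
      have "1 + real (K * M) \<le> M * (1 + real K)" using M by (simp add: algebra_simps)
      moreover have "0 < 1 + real (K * M)" by (simp add: add_pos_nonneg)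
      ultimately show ?thesis by (simp add: field_simps)
    qed
    finally show ?case using Suc by (simp add: distrib_left)
  qed simp
  obtain K :: nat where K: "exp (M * (real M * M + 4 * M)) < real K"
    using reals_Archimedean2 by blast
  have "M * (real M * M + 4 * M) < ln (1 + real K)"
    using K ln_less_cancel_iff[of "exp (M * (real M * M + 4 * M))" "1 + real K"] by simp
  moreover have "ln (1 + real K) \<le> M * (real M * M + 4 * M)"
    using *[of K] mult_left_mono[OF sum_g_lower, of M K] by simp
  ultimately show False by linarith
qed

end

section \<open>Subgroups of the unit group that contain all squares, and products of split
  primes\<close>

section \<open>Products of split primes in residue classes\<close>

text \<open>Residue classes are handled as congruence-closed sets of naturals. Inverses come for
  free: the inverse of x is x times the square of that inverse.\<close>

definition unit_subgroup :: "nat \<Rightarrow> nat set \<Rightarrow> bool" where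
  "unit_subgroup M K \<longleftrightarrow> (\<forall>x\<in>K. coprime x M) \<and> (\<forall>x y. x \<in> K \<longrightarrow> [x = y] (mod M) \<longrightarrow> y \<in> K)
     \<and> (\<forall>x. coprime x M \<longrightarrow> x * x \<in> K) \<and> (\<forall>x\<in>K. \<forall>y\<in>K. x * y \<in> K)"

lemma unit_subgroupD:
  assumes "unit_subgroup M K"
  shows unit_subgroup_coprime: "x \<in> K \<Longrightarrow> coprime x M"
    and unit_subgroup_cong: "x \<in> K \<Longrightarrow> [x = y] (mod M) \<Longrightarrow> y \<in> K"
    and unit_subgroup_square: "coprime x M \<Longrightarrow> x * x \<in> K"
    and unit_subgroup_mult: "x \<in> K \<Longrightarrow> y \<in> K \<Longrightarrow> x * y \<in> K"
  using assms unfolding unit_subgroup_def by blast+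

lemma unit_inverse_exists:
  fixes x M :: nat
  assumes "coprime x M"
  obtains x' where "[x * x' = 1] (mod M)" "coprime x' M"
proof -
  obtain x' where x': "[x * x' = 1] (mod M)" using cong_solve_coprime_nat[OF assms] by auto
  then have "coprime (x * x') M" by (rule cong_imp_coprime[OF cong_sym]) simp
  then show ?thesis using that x' by simp
qed

lemma unit_subgroup_cancel:
  assumes K: "unit_subgroup M K" and "x \<in> K" "x * y \<in> K"
  shows "y \<in> K"
proof -
  have cop: "coprime x M" using unit_subgroup_coprime[OF K assms(2)] .
  then obtain x' where x': "[x * x' = 1] (mod M)" "coprime x' M" by (rule unit_inverse_exists)
  have "(x' * x') * (x * (x * y)) \<in> K" 
    by (intro unit_subgroup_mult[OF K] unit_subgroup_square[OF K] assms x'(2))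
  moreover have "[(x * x') * (x * x') * y = 1 * 1 * y] (mod M)" by (intro cong_mult x'(1) cong_refl)
  then have "[(x' * x') * (x * (x * y)) = y] (mod M)" by (simp add: ac_simps)
  ultimately show ?thesis by (rule unit_subgroup_cong[OF K])
qed

text \<open>Maximality forces index 2 in the unit group, so the sign that is 1 exactly on
  \<open>K\<close> is a real character; it takes the value -1 at \<open>c\<close>.\<close>

lemma rchar_of_maximal_unit_subgroup:
  assumes M: "M > 0" and K: "unit_subgroup M K" and c: "coprime c M" "c \<notin> K"
    and max: "\<And>L. unit_subgroup M L \<Longrightarrow> c \<notin> L \<Longrightarrow> K \<subseteq> L \<Longrightarrow> L = K"
  shows "rchar M (\<lambda>x. if x \<in> K then 1 else if coprime x M then - 1 else 0)"
proof -
  note cop = unit_subgroup_coprime[OF K] and congK = unit_subgroup_cong[OF K]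
    and sq = unit_subgroup_square[OF K] and mulK = unit_subgroup_mult[OF K]
  \<comment> \<open>Units square into K, so K together with xK is again a subgroup and by maximality contains c.\<close>
  have coset: "x * c \<in> K" if x: "coprime x M" "x \<notin> K" for x
  proof -
    let ?L = "K \<union> {z. \<exists>k\<in>K. [z = x * k] (mod M)}"
    have "unit_subgroup M ?L"
      unfolding unit_subgroup_def
    proof (intro conjI allI impI ballI)
      fix y assume "y \<in> ?L"
      then show "coprime y M" using cop x cong_imp_coprime[OF cong_sym] by fastforce
    next
      fix y z assume "y \<in> ?L" "[y = z] (mod M)"
      then show "z \<in> ?L" using congK by (auto intro: cong_trans[OF cong_sym])
    next
      fix y z assume "y \<in> ?L" "z \<in> ?L"
      then consider "y \<in> K" "z \<in> K" | k where "k \<in> K" "[y = x * k] (mod M)" "z \<in> K"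
        | k where "k \<in> K" "[z = x * k] (mod M)" "y \<in> K"
        | k l where "k \<in> K" "[y = x * k] (mod M)" "l \<in> K" "[z = x * l] (mod M)" by blast
      then show "y * z \<in> ?L"
      proof cases
        case 2
        then have "[y * z = x * k * z] (mod M)" by (intro cong_mult) auto
        then show ?thesis using mulK[OF 2(1,3)] by (auto simp: mult.assoc)
      next
        case 3
        then have "[y * z = y * (x * k)] (mod M)" by (intro cong_mult) auto
        then have "[y * z = x * (k * y)] (mod M)" by (simp add: ac_simps)
        then show ?thesis using mulK[OF 3(1,3)] by blast
      next
        case 4
        then have "[y * z = (x * k) * (x * l)] (mod M)" by (intro cong_mult) auto
        then have "[(x * x) * (k * l) = y * z] (mod M)" by (simp add: ac_simps cong_sym)
        then show ?thesis using congK mulK sq x(1) 4 by blast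
      qed (use mulK in auto)
    qed (use sq in auto)
    moreover have "x \<in> ?L" using sq[of 1] by (auto intro!: bexI[of _ 1])
    ultimately have "c \<in> ?L" using max[of ?L] x(2) by blast
    then obtain k where "k \<in> K" "[c = x * k] (mod M)" using c by blast
    then have "[x * c = x * (x * k)] (mod M)" by (intro cong_mult) auto
    then have "[(x * x) * k = x * c] (mod M)" by (simp add: ac_simps cong_sym)
    then show ?thesis using congK mulK sq x(1) \<open>k \<in> K\<close> by blast
  qed
  \<comment> \<open>Both x c and y c lie in \<open>K\<close>; cancelling the square of
    \<open>c\<close> from their product leaves x y.\<close>
  have nonK: "x * y \<in> K" if "coprime x M" "coprime y M" "x \<notin> K" "y \<notin> K" for x y
  proof -
    have "(x * c) * (y * c) \<in> K" by (intro mulK coset that)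
    then have "(c * c) * (x * y) \<in> K" by (simp add: ac_simps)
    then show ?thesis by (rule unit_subgroup_cancel[OF K sq[OF c(1)]])
  qed
  have cancel: "y \<in> K" if "x \<in> K" "x * y \<in> K" for x y using unit_subgroup_cancel[OF K that] .
  have cancel': "x \<in> K" if "y \<in> K" "x * y \<in> K" for x y using cancel[OF that(1), of x] that(2) by (simp only: mult.commute)
  show ?thesis
    unfolding rchar_def
  proof (intro conjI allI impI)
    fix m n :: nat
    show "(if m * n \<in> K then 1 else if coprime (m * n) M then - 1 else 0) =
         (if m \<in> K then 1 else if coprime m M then - 1 else 0) *
         (if n \<in> K then 1 else if coprime n M then - 1 else (0::int))"
    proof (cases "coprime m M \<and> coprime n M")
      case True
      have "m * n \<in> K \<longleftrightarrow> (m \<in> K \<longleftrightarrow> n \<in> K)"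
        using True mulK[of m n] nonK[of m n] cancel[of m n] cancel'[of n m] by blast
      then show ?thesis using True by simp
    next
      case False
      then have "m * n \<notin> K" "m \<notin> K \<or> n \<notin> K" using cop[of m] cop[of n] cop[of "m * n"] by auto
      then show ?thesis using False by (auto dest: cop)
    qed
  next
    fix m n :: nat assume *: "[m = n] (mod M)"
    have "m \<in> K \<longleftrightarrow> n \<in> K" using congK * cong_sym by blast
    moreover have "coprime m M \<longleftrightarrow> coprime n M" using cong_imp_coprime * cong_sym by blast
    ultimately show "(if m \<in> K then 1 else if coprime m M then - 1 else (0::int)) =
         (if n \<in> K then 1 else if coprime n M then - 1 else 0)" by simp
  qed (use M cop in auto)
qed

text \<open>The subgroups are infinite sets of naturals, so their size is measured by the elements
  below \<open>M\<close>. This count is bounded, and by congruence closure it separates nested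
  subgroups.\<close>

lemma maximal_unit_subgroup_exists:
  assumes "M > 0" "unit_subgroup M H" "c \<notin> H"
  obtains K where "unit_subgroup M K" "c \<notin> K" "H \<subseteq> K"
    "\<And>L. unit_subgroup M L \<Longrightarrow> c \<notin> L \<Longrightarrow> K \<subseteq> L \<Longrightarrow> L = K"
proof -
  define S where "S = {K. unit_subgroup M K \<and> c \<notin> K \<and> H \<subseteq> K}"
  have eqI: "K = L" if "K \<subseteq> L" "unit_subgroup M K" "unit_subgroup M L" "card (K \<inter> {..<M}) = card (L \<inter> {..<M})" for K L
  proof
    have *: "K \<inter> {..<M} = L \<inter> {..<M}" by (rule card_subset_eq) (use that in auto)
    show "L \<subseteq> K"
    proof
      fix x assume "x \<in> L"
      then have "x mod M \<in> L \<inter> {..<M}" using unit_subgroup_cong[OF that(3), of x "x mod M"] \<open>M > 0\<close> by simp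
      then have "x mod M \<in> K" using * by blast
      then show "x \<in> K" using unit_subgroup_cong[OF that(2), of "x mod M" x] by simp
    qed
  qed (fact that)
  have "\<exists>K\<in>S. \<forall>L\<in>S. card (L \<inter> {..<M}) \<le> card (K \<inter> {..<M})"
  proof -
    have "\<And>K. K \<in> S \<Longrightarrow> card (K \<inter> {..<M}) \<le> M"
      by (metis card_lessThan card_mono finite_lessThan inf_le2)
    moreover have "H \<in> S" using assms unfolding S_def by blast
    ultimately show ?thesis
      using ex_has_greatest_nat[of "\<lambda>K. K \<in> S" H "\<lambda>K. card (K \<inter> {..<M})" "Suc M"] by (auto simp: le_imp_less_Suc)
  qed
  then obtain K where K: "K \<in> S" "\<And>L. L \<in> S \<Longrightarrow> card (L \<inter> {..<M}) \<le> card (K \<inter> {..<M})" by blast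
  show ?thesis
  proof (rule that)
    fix L assume L: "unit_subgroup M L" "c \<notin> L" "K \<subseteq> L"
    then have "L \<in> S" using K(1) unfolding S_def by auto
    moreover have "card (K \<inter> {..<M}) \<le> card (L \<inter> {..<M})" by (rule card_mono) (use L in auto)
    ultimately show "L = K" using eqI[of K L] K L unfolding S_def by (metis (mono_tags, lifting) le_antisym mem_Collect_eq)
  qed (use K in \<open>auto simp: S_def\<close>)
qed

text \<open>A substitute for a prime in the class of \<open>c\<close>: a product of primes with
  \<open>\<chi> p = 1\<close>, in that class up to the square of a unit.\<close>

lemma rchar_split_primes_represent:
  assumes \<chi>: "rchar M \<chi>" and c: "\<chi> c = 1"
  obtains q s where "squarefree q" "\<And>p. prime p \<Longrightarrow> p dvd q \<Longrightarrow> \<chi> p = 1"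
    "coprime s M" "[q = c * s\<^sup>2] (mod M)"
proof -
  define good where "good q \<longleftrightarrow> q > 0 \<and> (\<forall>p. prime p \<longrightarrow> p dvd q \<longrightarrow> \<chi> p = 1)" for q
  \<comment> \<open>The classes that contain a product of split primes, up to unit squares.\<close>
  define H where "H = {x. coprime x M \<and> (\<exists>q s. good q \<and> coprime s M \<and> [q = x * s\<^sup>2] (mod M))}"
  have M: "M > 0" using \<chi> rchar_pos by blast
  have cop: "coprime c M" using c rchar_nonzero_iff[OF \<chi>, of c] by simp
  have H: "unit_subgroup M H"
    unfolding unit_subgroup_def
  proof (intro conjI allI impI ballI)
    fix x y assume *: "x \<in> H" "[x = y] (mod M)"
    then obtain q s where "good q" "coprime s M" "[q = x * s\<^sup>2] (mod M)" unfolding H_def by blast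
    moreover have "[x * s\<^sup>2 = y * s\<^sup>2] (mod M)" using * by (intro cong_mult) auto
    moreover have "coprime y M" using * cong_imp_coprime unfolding H_def by blast
    ultimately show "y \<in> H" unfolding H_def using cong_trans by blast
  next
    fix x assume x: "coprime x M"
    then obtain s where s: "[x * s = 1] (mod M)" "coprime s M" by (rule unit_inverse_exists)
    have "[(x * s) * (x * s) = 1 * 1] (mod M)" by (intro cong_mult s)
    then have "[1 = x * x * s\<^sup>2] (mod M)" by (simp add: power2_eq_square ac_simps cong_sym)
    moreover have "good 1" unfolding good_def by auto
    ultimately show "x * x \<in> H" unfolding H_def using x s by auto
  next
    fix x y assume *: "x \<in> H" "y \<in> H"
    then obtain q s r t where q: "good q" "coprime s M" "[q = x * s\<^sup>2] (mod M)"
      and r: "good r" "coprime t M" "[r = y * t\<^sup>2] (mod M)" unfolding H_def by blast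
    have "good (q * r)" using q r unfolding good_def by (auto simp: prime_dvd_mult_iff)
    moreover have "[q * r = (x * s\<^sup>2) * (y * t\<^sup>2)] (mod M)" using q r by (intro cong_mult)
    then have "[q * r = (x * y) * (s * t)\<^sup>2] (mod M)" by (simp add: power_mult_distrib ac_simps)
    moreover have "coprime (s * t) M" "coprime (x * y) M" using q r * unfolding H_def by auto
    ultimately show "x * y \<in> H" unfolding H_def by blast
  qed (auto simp: H_def)
  have "c \<in> H"
  proof (rule ccontr)
    assume "c \<notin> H"
    then obtain K where K: "unit_subgroup M K" "c \<notin> K" "H \<subseteq> K"
      "\<And>L. unit_subgroup M L \<Longrightarrow> c \<notin> L \<Longrightarrow> K \<subseteq> L \<Longrightarrow> L = K"
      using maximal_unit_subgroup_exists[OF M H] by metis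
    \<comment> \<open>The character with kernel \<open>K\<close> is 1 at all split primes, since
      they lie in \<open>H\<close>, but -1 at \<open>c\<close>: precisely a
      \<open>char_pair\<close>.\<close>
    let ?\<psi> = "\<lambda>x. if x \<in> K then 1 else if coprime x M then - 1 else (0::int)"
    have "rchar M ?\<psi>" by (rule rchar_of_maximal_unit_subgroup[OF M K(1) cop K(2,4)])
    moreover have "?\<psi> p = 1" if "prime p" "\<chi> p = 1" for p
    proof -
      have "good p" using that primes_dvd_imp_eq prime_gt_0_nat unfolding good_def by blast
      moreover have "coprime p M" using that rchar_nonzero_iff[OF \<chi>, of p] by simp
      ultimately have "p \<in> H" unfolding H_def using \<open>good p\<close> by (intro CollectI conjI exI[of _ p] exI[of _ 1]) auto
      then show ?thesis using K(3) by auto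
    qed
    ultimately have "char_pair M \<chi> ?\<psi> c" using \<chi> c cop K(2) by (auto simp: char_pair_def)
    then show False by (rule char_pair.inconsistent)
  qed
  then obtain q s where q: "good q" "coprime s M" "[q = c * s\<^sup>2] (mod M)" unfolding H_def by blast
  \<comment> \<open>Dropping the square part leaves a squarefree number with no new prime factors;
    its class changes only by a unit square, absorbed into \<open>s\<close>.\<close>
  define u where "u = squarefree_part q"
  define t where "t = square_part q"
  have qut: "q = u * t\<^sup>2" unfolding u_def t_def by (rule squarefree_decompose)
  have "coprime q M" using q cop cong_imp_coprime[OF cong_sym[OF q(3)]] by simp
  then have "coprime t M" unfolding qut by auto
  then obtain t' where t': "[t * t' = 1] (mod M)" and ct': "coprime t' M" by (rule unit_inverse_exists)
  have "[u * ((t * t') * (t * t')) = u * (1 * 1)] (mod M)" by (intro cong_mult t' cong_refl)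
  then have "[u = q * t'\<^sup>2] (mod M)" unfolding qut by (simp add: power2_eq_square ac_simps cong_sym)
  moreover have "[q * t'\<^sup>2 = c * s\<^sup>2 * t'\<^sup>2] (mod M)" using q by (intro cong_mult) auto
  ultimately have "[u = c * s\<^sup>2 * t'\<^sup>2] (mod M)" by (rule cong_trans)
  then have "[u = c * (s * t')\<^sup>2] (mod M)" by (simp add: power_mult_distrib mult.assoc)
  moreover have "squarefree u" unfolding u_def by simp
  moreover have "\<chi> p = 1" if "prime p" "p dvd u" for p using q(1) that unfolding good_def qut by auto
  moreover have "coprime (s * t') M" using q ct' by simp
  ultimately show ?thesis using that by blast
qed

section \<open>Legendre symbols as functions of the denominator\<close>

section \<open>Kronecker characters\<close>

lemma Legendre_cong: "[a = b] (mod p) \<Longrightarrow> Legendre a p = Legendre b p"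
  by (simp add: Legendre_def QuadRes_def cong_def)

text \<open>Two numbers among -1, 0, 1 differ by at most 2, which is less than
  \<open>p\<close>.\<close>

lemma Legendre_eqI:
  assumes "p > 2" "x \<in> {- 1, 0, 1}" "[Legendre a p = x] (mod p)"
  shows "Legendre a p = x"
proof (rule ccontr)
  assume "Legendre a p \<noteq> x"
  moreover have "Legendre a p \<in> {- 1, 0, 1}" unfolding Legendre_def by simp
  ultimately have "\<bar>Legendre a p - x\<bar> \<in> {1, 2}" using assms(2) by auto
  moreover have "p dvd \<bar>Legendre a p - x\<bar>" using assms(3) by (simp add: cong_iff_dvd_diff)
  ultimately have "p \<le> \<bar>Legendre a p - x\<bar>" by (intro zdvd_imp_le) auto
  then show False using assms(1) \<open>\<bar>Legendre a p - x\<bar> \<in> {1, 2}\<close> by auto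
qed

lemma Legendre_mult:
  assumes "prime p" "2 < p"
  shows "Legendre (a * b) (int p) = Legendre a p * Legendre b p"
proof (rule Legendre_eqI)
  have "[Legendre (a * b) p = (a * b) ^ ((p - 1) div 2)] (mod p)" using euler_criterion[OF assms] .
  also have "(a * b) ^ ((p - 1) div 2) = a ^ ((p - 1) div 2) * b ^ ((p - 1) div 2)" by (rule power_mult_distrib)
  also have "[\<dots> = Legendre a p * Legendre b p] (mod p)"
    by (intro cong_mult cong_sym[OF euler_criterion[OF assms]])
  finally show "[Legendre (a * b) p = Legendre a p * Legendre b p] (mod p)" .
qed (use assms in \<open>auto simp: Legendre_def\<close>)

lemma Legendre_nonzero: "prime p \<Longrightarrow> coprime m p \<Longrightarrow> Legendre (int m) (int p) \<in> {- 1, 1}"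
  unfolding Legendre_def
  by (auto simp: cong_0_iff)

lemma Legendre_minus_1:
  assumes "prime p" "2 < p"
  shows "Legendre (- 1) (int p) = (if p mod 4 = 1 then 1 else - 1)"
proof (rule Legendre_eqI)
  have "odd p" using assms prime_odd_nat by blast
  then have "even ((p - 1) div 2) \<longleftrightarrow> p mod 4 = 1" using assms(2) by presburger
  then have "(- 1) ^ ((p - 1) div 2) = (if p mod 4 = 1 then 1 else - 1 :: int)" by simp
  then show "[Legendre (- 1) p = (if p mod 4 = 1 then 1 else - 1)] (mod p)"
    using euler_criterion[OF assms, of "- 1"] by simp
qed (use assms in auto)

text \<open>Gauss's lemma: with z = (p - 1) / 2, the doubles 2x for 1 <= x <= z stay below
  \<open>p\<close>, and those exceeding z come from z / 2 < x <= z. Their number has the parity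
  stated.\<close>

lemma Legendre_2:
  assumes "prime p" "2 < p"
  shows "Legendre 2 (int p) = (if p mod 8 = 1 \<or> p mod 8 = 7 then 1 else - 1)"
proof -
  interpret GAUSS p 2
    using assms by unfold_locales (auto simp: cong_0_iff dest: zdvd_imp_le)
  define z where "z = (int p - 1) div 2"
  have z: "int p = 2 * z + 1" unfolding z_def using p_eq2 by simp
  have "C = (\<lambda>x. x * 2) ` A"
    unfolding C_def B_def A_def image_image z_def[symmetric] by (intro image_cong) (auto simp: z)
  then have "E = (\<lambda>x. x * 2) ` {z div 2<..z}"
    unfolding E_def A_def z_def[symmetric] using assms(2) z by (auto simp: image_iff)
  then have "card E = nat (z - z div 2)" by (simp add: card_image inj_on_def)
  moreover have "even (nat (z - z div 2)) \<longleftrightarrow> p mod 8 = 1 \<or> p mod 8 = 7"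
  proof -
    have "z > 0" using z assms(2) by simp
    then have "even (nat (z - z div 2)) \<longleftrightarrow> even (z - z div 2)" by (simp add: even_nat_iff)
    also have "\<dots> \<longleftrightarrow> int p mod 8 = 1 \<or> int p mod 8 = 7" unfolding z by presburger
    also have "int p mod 8 = int (p mod 8)" by (simp add: zmod_int)
    also have "int (p mod 8) = 1 \<or> int (p mod 8) = 7 \<longleftrightarrow> p mod 8 = 1 \<or> p mod 8 = 7" by linarith
    finally show ?thesis .
  qed
  ultimately show ?thesis using gauss_lemma by simp
qed

lemma Legendre_reciprocity:
  assumes "prime p" "2 < p" "prime r" "2 < r" "p \<noteq> r"
  shows "Legendre (int p) (int r) = Legendre (int r) (int p) * (if p mod 4 = 3 \<and> r mod 4 = 3 then - 1 else 1)"
proof -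
  have "odd p" "odd r" using assms prime_odd_nat by blast+
  then have "even ((p - 1) div 2 * ((r - 1) div 2)) \<longleftrightarrow> \<not> (p mod 4 = 3 \<and> r mod 4 = 3)"
    unfolding even_mult_iff using assms(2,4) by presburger
  then have "(- 1) ^ ((p - 1) div 2 * ((r - 1) div 2)) = (if p mod 4 = 3 \<and> r mod 4 = 3 then - 1 else 1 :: int)" by simp
  then have "Legendre p r * Legendre r p = (if p mod 4 = 3 \<and> r mod 4 = 3 then - 1 else 1)"
    using Quadratic_Reciprocity[OF assms] by simp
  moreover have "Legendre r p \<in> {- 1, 1}"
    using assms primes_coprime by (intro Legendre_nonzero) auto
  ultimately show ?thesis by auto
qed

lemma Legendre_3:
  "Legendre (int n) 3 = (if n mod 3 = 0 then 0 else if n mod 3 = 1 then 1 else - 1)"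
proof -
  have "Legendre 2 3 = (- 1 :: int)" using Legendre_2[of 3] by simp
  moreover have "Legendre 1 3 = (1 :: int)" using Legendre_mult[of 3 1 1] by (simp add: Legendre_def cong_def QuadRes_def exI[of _ 1])
  moreover have "Legendre 0 3 = (0 :: int)" by (simp add: Legendre_def)
  moreover have "Legendre (int n) 3 = Legendre (int (n mod 3)) 3"
    by (rule Legendre_cong) (simp add: cong_def zmod_int)
  moreover have "n mod 3 = 0 \<or> n mod 3 = 1 \<or> n mod 3 = 2" by presburger
  ultimately show ?thesis by fastforce
qed

text \<open>The sign from -1 cancels the sign from reciprocity, so only \<open>p\<close> modulo 3
  matters.\<close>

lemma Legendre_minus_3:
  assumes "prime p" "3 < p"
  shows "Legendre (- 3) (int p) = Legendre (int p) 3"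
proof -
  have "odd p" using assms prime_odd_nat[of p] by simp
  then have p4: "p mod 4 = 1 \<or> p mod 4 = 3" by presburger
  have "Legendre (- 3) p = Legendre (- 1) p * Legendre 3 p"
    using Legendre_mult[of p "- 1" 3] assms by simp
  also have "Legendre 3 p = Legendre p 3 * (if p mod 4 = 3 then - 1 else 1)"
    using Legendre_reciprocity[of 3 p] assms by simp
  finally show ?thesis using Legendre_minus_1[of p] assms p4 by auto
qed

lemma odd_of_coprime: "even M \<Longrightarrow> coprime m M \<Longrightarrow> odd (m::nat)"
  using coprime_common_divisor[of m M 2] by auto

lemma coprime_of_dvd_modulus: "d dvd M \<Longrightarrow> coprime m M \<Longrightarrow> coprime (m::nat) d"
  by (rule coprime_divisors[of m m d M]) auto

lemma gt_2_of_coprime: "even M \<Longrightarrow> prime r \<Longrightarrow> coprime r M \<Longrightarrow> 2 < (r::nat)"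
  using odd_of_coprime[of M r] prime_ge_2_nat[of r] by (cases "r = 2") auto

text \<open>The Kronecker symbol (d/.) as a character modulo \<open>M\<close>. It is prescribed at
  primes only; multiplicativity determines the rest.\<close>

definition kronecker_char :: "nat \<Rightarrow> int \<Rightarrow> (nat \<Rightarrow> int) \<Rightarrow> bool" where
  "kronecker_char M d f \<longleftrightarrow> rchar M f \<and> (\<forall>r. prime r \<longrightarrow> coprime r M \<longrightarrow> f r = Legendre d (int r))"

lemma kronecker_char_mult:
  assumes "even M" "kronecker_char M d f" "kronecker_char M d' f'"
  shows "kronecker_char M (d * d') (\<lambda>m. f m * f' m)"
  using assms gt_2_of_coprime[OF assms(1)] unfolding kronecker_char_def
  by (auto simp: rchar_times Legendre_mult)

lemma rcharI:
  assumes "M > 0"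
    and "\<And>m n. coprime m M \<Longrightarrow> coprime n M \<Longrightarrow> g (m * n) = g m * g n"
    and "\<And>m n. coprime m M \<Longrightarrow> coprime n M \<Longrightarrow> [m = n] (mod M) \<Longrightarrow> g m = g n"
    and "\<And>m. coprime m M \<Longrightarrow> g m \<in> {- 1, 1}"
  shows "rchar M (\<lambda>m. if coprime m M then g m else 0)"
  unfolding rchar_def
proof (intro conjI allI impI)
  fix m n :: nat assume *: "[m = n] (mod M)"
  have "coprime m M \<longleftrightarrow> coprime n M"
    using cong_imp_coprime[OF *] cong_imp_coprime[OF cong_sym[OF *]] by blast
  then show "(if coprime m M then g m else 0) = (if coprime n M then g n else 0)"
    using assms(3)[OF _ _ *] by simp
next
  fix m n
  show "(if coprime (m * n) M then g (m * n) else 0)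
      = (if coprime m M then g m else 0) * (if coprime n M then g n else 0)"
    using assms(2)[of m n] by simp
next
  fix m
  show "(if coprime m M then g m else 0) \<in> {- 1, 0, 1}"
    and "(if coprime m M then g m else 0) \<noteq> 0 \<longleftrightarrow> coprime m M"
    using assms(4)[of m] by auto
qed (rule assms(1))

lemma kronecker_char_1:
  assumes "M > 0" "even M"
  shows "kronecker_char M 1 (\<lambda>m. if coprime m M then 1 else 0)"
proof -
  have "Legendre 1 (int r) = 1" if "prime r" for r
    using that prime_gt_1_nat[OF that] unfolding Legendre_def QuadRes_def by (auto simp: cong_0_iff intro!: exI[of _ 1])
  then show ?thesis unfolding kronecker_char_def using rcharI[OF assms(1), of "\<lambda>_. 1"] by auto
qed

lemma kronecker_char_minus_1:
  assumes "M > 0" "4 dvd M"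
  shows "kronecker_char M (- 1) (\<lambda>m. if coprime m M then (if m mod 4 = 1 then 1 else - 1) else 0)"
  unfolding kronecker_char_def
proof (intro conjI allI impI)
  have ev: "even M" using assms(2) by presburger
  show "rchar M (\<lambda>m. if coprime m M then (if m mod 4 = 1 then 1 else - 1) else 0)"
  proof (rule rcharI)
    fix m n :: nat assume "coprime m M" "coprime n M"
    then have "odd m" "odd n" using ev odd_of_coprime by blast+
    then have "m mod 4 \<in> {1, 3}" "n mod 4 \<in> {1, 3}" by (simp_all; presburger)+
    moreover have "m * n mod 4 = (m mod 4) * (n mod 4) mod 4" by (simp add: mod_mult_eq)
    ultimately show "(if m * n mod 4 = 1 then 1 else - 1) = (if m mod 4 = 1 then 1 else - 1) * (if n mod 4 = 1 then 1 else (- 1 :: int))"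
      by auto
  next
    fix m n :: nat assume "[m = n] (mod M)"
    then have "m mod 4 = n mod 4" using assms(2) cong_dvd_modulus_nat unfolding cong_def by blast
    then show "(if m mod 4 = 1 then 1 else - 1) = (if n mod 4 = 1 then 1 else (- 1 :: int))" by simp
  qed (use assms in auto)
  fix r assume "prime r" "coprime r M"
  then show "(if coprime r M then (if r mod 4 = 1 then 1 else - 1) else 0) = Legendre (- 1) (int r)"
    using Legendre_minus_1 gt_2_of_coprime[OF ev] by simp
qed

lemma kronecker_char_2:
  assumes "M > 0" "8 dvd M"
  shows "kronecker_char M 2 (\<lambda>m. if coprime m M then (if m mod 8 = 1 \<or> m mod 8 = 7 then 1 else - 1) else 0)"
  unfolding kronecker_char_def
proof (intro conjI allI impI)
  have ev: "even M" using assms(2) by presburger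
  show "rchar M (\<lambda>m. if coprime m M then (if m mod 8 = 1 \<or> m mod 8 = 7 then 1 else - 1) else 0)"
  proof (rule rcharI)
    fix m n :: nat assume "coprime m M" "coprime n M"
    then have "odd m" "odd n" using ev odd_of_coprime by blast+
    then have mn: "m mod 8 \<in> {1, 3, 5, 7}" "n mod 8 \<in> {1, 3, 5, 7}" by (simp_all; presburger)+
    have "(if x * y mod 8 = 1 \<or> x * y mod 8 = 7 then 1 else - 1)
        = (if x = 1 \<or> x = 7 then 1 else - 1) * (if y = 1 \<or> y = 7 then 1 else (- 1 :: int))"
      if "x \<in> {1, 3, 5, 7}" "y \<in> {1, 3, 5, 7}" for x y :: nat
      using that by auto
    from this[OF mn] show "(if m * n mod 8 = 1 \<or> m * n mod 8 = 7 then 1 else - 1)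
        = (if m mod 8 = 1 \<or> m mod 8 = 7 then 1 else - 1) * (if n mod 8 = 1 \<or> n mod 8 = 7 then 1 else (- 1 :: int))"
      by (simp only: mod_mult_eq)
  next
    fix m n :: nat assume "[m = n] (mod M)"
    then have "m mod 8 = n mod 8" using assms(2) cong_dvd_modulus_nat unfolding cong_def by blast
    then show "(if m mod 8 = 1 \<or> m mod 8 = 7 then 1 else - 1) = (if n mod 8 = 1 \<or> n mod 8 = 7 then 1 else (- 1 :: int))" by simp
  qed (use assms in auto)
  fix r assume "prime r" "coprime r M"
  then show "(if coprime r M then (if r mod 8 = 1 \<or> r mod 8 = 7 then 1 else - 1) else 0) = Legendre 2 (int r)"
    using Legendre_2 gt_2_of_coprime[OF ev] by simp
qed

text \<open>Reciprocity replaces (p/r) by (r/p) and a sign depending on \<open>r\<close> modulo 4,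
  an expression that is visibly periodic in \<open>r\<close>.\<close>

lemma kronecker_char_odd_prime:
  assumes "M > 0" "4 * p dvd M" "prime p" "2 < p"
  shows "kronecker_char M (int p)
    (\<lambda>m. if coprime m M then Legendre (int m) (int p) * (if p mod 4 = 3 \<and> m mod 4 = 3 then - 1 else 1) else 0)"
  unfolding kronecker_char_def
proof (intro conjI allI impI)
  have dvd: "4 dvd M" "p dvd M" using assms(2) dvd_mult_left dvd_mult_right by blast+
  have ev: "even M" using dvd(1) by presburger
  show "rchar M (\<lambda>m. if coprime m M then Legendre (int m) (int p) * (if p mod 4 = 3 \<and> m mod 4 = 3 then - 1 else 1) else 0)"
  proof (rule rcharI)
    fix m n :: nat assume "coprime m M" "coprime n M"
    then have "odd m" "odd n" using ev odd_of_coprime by blast+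
    then have "m mod 4 \<in> {1, 3}" "n mod 4 \<in> {1, 3}" by (simp_all; presburger)+
    moreover have "m * n mod 4 = (m mod 4) * (n mod 4) mod 4" by (simp add: mod_mult_eq)
    ultimately show "Legendre (int (m * n)) (int p) * (if p mod 4 = 3 \<and> m * n mod 4 = 3 then - 1 else 1) =
        Legendre (int m) (int p) * (if p mod 4 = 3 \<and> m mod 4 = 3 then - 1 else 1) *
        (Legendre (int n) (int p) * (if p mod 4 = 3 \<and> n mod 4 = 3 then - 1 else 1))"
      using Legendre_mult[OF assms(3,4), of "int m" "int n"] by auto
  next
    fix m n :: nat assume *: "[m = n] (mod M)"
    then have "m mod 4 = n mod 4" using dvd cong_dvd_modulus_nat unfolding cong_def by blast
    moreover have "Legendre (int m) (int p) = Legendre (int n) (int p)"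
      by (rule Legendre_cong) (use * dvd cong_dvd_modulus_nat cong_int_iff in blast)
    ultimately show "Legendre (int m) (int p) * (if p mod 4 = 3 \<and> m mod 4 = 3 then - 1 else 1) =
        Legendre (int n) (int p) * (if p mod 4 = 3 \<and> n mod 4 = 3 then - 1 else 1)" by simp
  next
    fix m assume "coprime m M"
    then have "Legendre (int m) (int p) \<in> {- 1, 1}"
      using Legendre_nonzero[OF assms(3)] coprime_of_dvd_modulus[OF dvd(2)] by blast
    then show "Legendre (int m) (int p) * (if p mod 4 = 3 \<and> m mod 4 = 3 then - 1 else 1) \<in> {- 1, 1}" by auto
  qed (use assms in auto)
  fix r assume r: "prime r" "coprime r M"
  then have "p \<noteq> r" using dvd(2) coprime_of_dvd_modulus[OF dvd(2), of r] assms(3) by auto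
  then show "(if coprime r M then Legendre (int r) (int p) * (if p mod 4 = 3 \<and> r mod 4 = 3 then - 1 else 1) else 0)
      = Legendre (int p) (int r)"
    using Legendre_reciprocity[OF assms(3,4) r(1) gt_2_of_coprime[OF ev r]] r by simp
qed

text \<open>A product over the prime factors of \<open>n\<close>. At \<open>c\<close> congruent to
  -3 an odd factor p contributes (-3/p) = (p/3), and the factor 2 contributes -1 = (2/3) because
  \<open>c\<close> is 5 modulo 8.\<close>

lemma kronecker_char_exists:
  assumes "n > 0" "\<not> 3 dvd n" "8 * n dvd M" "M > 0"
  shows "\<exists>f. kronecker_char M (int n) f \<and> (\<forall>c. coprime c M \<longrightarrow> 8 * n dvd c + 3 \<longrightarrow> f c = Legendre (int n) 3)"
  using assms(1-3)
proof (induction n rule: less_induct)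
  case (less n)
  have ev: "even M" using less.prems(3) by (meson dvd_mult_left dvd_trans even_numeral)
  show ?case
  proof (cases "n = 1")
    case True
    then show ?thesis using kronecker_char_1[OF assms(4) ev] Legendre_3[of 1] by (intro exI conjI) auto
  next
    case False
    then obtain p where p: "prime p" "p dvd n" using prime_factor_nat by blast
    then obtain m where m: "n = p * m" by blast
    have m_less: "m < n" "m > 0" using less.prems m prime_gt_1_nat[OF p(1)] by auto
    have "\<not> 3 dvd m" "8 * m dvd M" using less.prems m dvd_trans[of "8 * m" "8 * n" M] by auto
    then obtain f where f: "kronecker_char M m f" "\<And>c. coprime c M \<Longrightarrow> 8 * m dvd c + 3 \<Longrightarrow> f c = Legendre m 3"
      using less.IH[OF m_less] by blast
    have dvd: "8 dvd M" "4 * p dvd M" using less.prems(3) m dvd_trans[of "4 * p" "8 * n" M]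
      by (auto dest: dvd_mult_left)
    have "\<exists>g. kronecker_char M p g \<and> (\<forall>c. coprime c M \<longrightarrow> 8 * p dvd c + 3 \<longrightarrow> g c = Legendre p 3)"
    proof (cases "p = 2")
      case True
      have "c mod 8 = 5" if "16 dvd c + 3" for c :: nat using that by presburger
      then show ?thesis using kronecker_char_2[OF assms(4) dvd(1)] Legendre_3[of 2] True by (intro exI conjI) auto
    next
      case False
      then have p2: "2 < p" using prime_ge_2_nat[OF p(1)] by simp
      have "p \<noteq> 3" using p(2) less.prems(2) by blast
      then have p3: "3 < p" using p2 by simp
      \<comment> \<open>Here \<open>c\<close> is 1 modulo 4, so the reciprocity sign is
        absent.\<close>
      have "Legendre (int c) (int p) = Legendre p 3 \<and> c mod 4 \<noteq> 3" if "8 * p dvd c + 3" for c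
      proof -
        have "8 dvd c + 3" "p dvd c + 3" using that dvd_mult_left dvd_mult_right by blast+
        have "c mod 4 \<noteq> 3" using \<open>8 dvd c + 3\<close> by presburger
        moreover have "int p dvd int c - (- 3)" using \<open>p dvd c + 3\<close> by (metis diff_minus_eq_add of_nat_add of_nat_dvd_iff of_nat_numeral)
        then have "Legendre c p = Legendre (- 3) p" by (intro Legendre_cong) (simp add: cong_iff_dvd_diff)
        ultimately show ?thesis using Legendre_minus_3[OF p(1) p3] by simp
      qed
      then show ?thesis using kronecker_char_odd_prime[OF assms(4) dvd(2) p(1) p2] by (intro exI conjI) auto
    qed
    then obtain g where g: "kronecker_char M p g" "\<And>c. coprime c M \<Longrightarrow> 8 * p dvd c + 3 \<Longrightarrow> g c = Legendre p 3"
      by blast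
    have "kronecker_char M n (\<lambda>c. g c * f c)" using kronecker_char_mult[OF ev g(1) f(1)] m by simp
    moreover have "g c * f c = Legendre n 3" if "coprime c M" "8 * n dvd c + 3" for c
    proof -
      have "8 * p dvd c + 3" "8 * m dvd c + 3"
        using that(2) dvd_trans[of "8 * p" "8 * n"] dvd_trans[of "8 * m" "8 * n"] unfolding m by auto
      then show ?thesis using f(2) g(2) that(1) Legendre_mult[of 3 p m] m by simp
    qed
    ultimately show ?thesis by blast
  qed
qed

section \<open>Reduction of positive ternary forms of determinant 3\<close>

section \<open>Ternary forms of determinant 3\<close>

text \<open>The integral symmetric matrix is ((a, f, e), (f, b, d), (e, d, c)).\<close>

definition ternary :: "int \<Rightarrow> int \<Rightarrow> int \<Rightarrow> int \<Rightarrow> int \<Rightarrow> int \<Rightarrow> int \<Rightarrow> int \<Rightarrow> int \<Rightarrow> int" where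
  "ternary a b c d e f x y z = a * x\<^sup>2 + b * y\<^sup>2 + c * z\<^sup>2 + 2 * d * y * z + 2 * e * x * z + 2 * f * x * y"

definition ternary_det :: "int \<Rightarrow> int \<Rightarrow> int \<Rightarrow> int \<Rightarrow> int \<Rightarrow> int \<Rightarrow> int" where
  "ternary_det a b c d e f = a * b * c + 2 * d * e * f - a * d\<^sup>2 - b * e\<^sup>2 - c * f\<^sup>2"

definition rep113 :: "int \<Rightarrow> bool" where
  "rep113 n \<longleftrightarrow> (\<exists>u v w. n = u\<^sup>2 + v\<^sup>2 + 3 * w\<^sup>2)"

definition rep122 :: "int \<Rightarrow> bool" where
  "rep122 n \<longleftrightarrow> (\<exists>u v w. n = u\<^sup>2 + 2 * v\<^sup>2 + 2 * v * w + 2 * w\<^sup>2)"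

lemma nearest_multiple:
  fixes a f :: int
  assumes "a > 0"
  obtains k where "2 * \<bar>f + k * a\<bar> \<le> a"
proof -
  \<comment> \<open>The integer nearest to f / a, so that f - m a is at most a / 2 in absolute
    value.\<close>
  define m where "m = (2 * f + a) div (2 * a)"
  have "2 * f + a = 2 * a * m + (2 * f + a) mod (2 * a)" unfolding m_def by simp
  then have "2 * (f + (- m) * a) = (2 * f + a) mod (2 * a) - a" by (simp add: algebra_simps)
  moreover have "0 \<le> (2 * f + a) mod (2 * a)" "(2 * f + a) mod (2 * a) < 2 * a" using assms by auto
  ultimately have "2 * \<bar>f + (- m) * a\<bar> \<le> a" unfolding abs_if by (auto split: if_splits)
  then show ?thesis by (rule that)
qed

lemma square_le_quarter:
  fixes a t :: int
  assumes "2 * \<bar>t\<bar> \<le> a"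
  shows "4 * t\<^sup>2 \<le> a\<^sup>2"
  using power_mono[OF assms, of 2] by (simp add: power_mult_distrib)

lemma ternary_det_3_represented:
  assumes "a > 0" "a * b - f\<^sup>2 > 0" "ternary_det a b c d e f = 3"
  shows "(\<forall>x y z. rep113 (ternary a b c d e f x y z)) \<or> (\<forall>x y z. rep122 (ternary a b c d e f x y z))"
  using assms
  \<comment> \<open>Gauss reduction: the first case shortens the first basis vector inside the plane of the first
    two, the second case lowers the leading minor, which is the leading coefficient of the adjoint
    form. When neither applies, 3a^2 <= 4A and A^2 <= 4a for the minor A, so a = 1 and A <= 2.\<close>
proof (induction "(nat a, nat (a * b - f\<^sup>2))" arbitrary: a b c d e f rule: wf_induct_rule[OF wf_lex_prod[OF wf_less_than wf_less_than]])
  case (1 a b f c d e)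
  note IH = 1(1) and a = 1(2) and A = 1(3) and det = 1(4)
  define A where "A = a * b - f\<^sup>2"
  define B where "B = a * d - e * f"
  have A0: "A > 0" using A unfolding A_def .
  show ?case
  proof (cases "\<exists>k. b + 2 * k * f + k\<^sup>2 * a < a")
    case True
    then obtain k where k: "b + 2 * k * f + k\<^sup>2 * a < a" by blast
    \<comment> \<open>The value of the form at (k, 1, 0), which becomes the first basis vector; the
      old first vector becomes the second.\<close>
    define a' where "a' = b + 2 * k * f + k\<^sup>2 * a"
    have id: "a' * a - (f + a * k)\<^sup>2 = A" unfolding a'_def A_def by (simp add: algebra_simps power2_eq_square)
    have "a' * a > 0" using id A0 zero_le_power2[of "f + a * k"] by linarith
    then have a': "a' > 0" using a by (simp add: zero_less_mult_iff)
    have "((nat a', nat (a' * a - (f + a * k)\<^sup>2)), nat a, nat (a * b - f\<^sup>2)) \<in> less_than <*lex*> less_than"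
      using k a unfolding a'_def by simp
    moreover have "ternary_det a' a c e (e * k + d) (f + a * k) = 3"
      using det unfolding ternary_det_def a'_def by (simp add: algebra_simps power2_eq_square)
    ultimately have "(\<forall>x y z. rep113 (ternary a' a c e (e * k + d) (f + a * k) x y z))
        \<or> (\<forall>x y z. rep122 (ternary a' a c e (e * k + d) (f + a * k) x y z))"
      using IH a' id A0 by auto
    moreover have "ternary a b c d e f x y z = ternary a' a c e (e * k + d) (f + a * k) y (x - k * y) z" for x y z
      unfolding ternary_def a'_def by (simp add: algebra_simps power2_eq_square)
    ultimately show ?thesis by presburger
  next
    case no1: False
    show ?thesis
    proof (cases "\<exists>k. a * (b * k\<^sup>2 + 2 * d * k + c) - (f * k + e)\<^sup>2 < A")
      case True
      then obtain k where k: "a * (b * k\<^sup>2 + 2 * d * k + c) - (f * k + e)\<^sup>2 < A" by blast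
      \<comment> \<open>The value at (0, k, 1), which becomes the second basis vector;
        \<open>A'\<close> is the new leading minor.\<close>
      define b' where "b' = b * k\<^sup>2 + 2 * d * k + c"
      define A' where "A' = a * b' - (f * k + e)\<^sup>2"
      have "A * A' = a * ternary_det a b c d e f + (A * k + B)\<^sup>2"
        unfolding A_def A'_def B_def b'_def ternary_det_def by (simp add: algebra_simps power2_eq_square)
      then have "A * A' > 0" using det a by (simp add: add_pos_nonneg)
      then have A': "A' > 0" using A0 by (simp add: zero_less_mult_iff)
      have "((nat a, nat (a * b' - (f * k + e)\<^sup>2)), nat a, nat (a * b - f\<^sup>2)) \<in> less_than <*lex*> less_than"
        using k A0 unfolding b'_def A_def by simp
      moreover have "ternary_det a b' b (b * k + d) f (f * k + e) = 3"
        using det unfolding ternary_det_def b'_def by (simp add: algebra_simps power2_eq_square)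
      ultimately have "(\<forall>x y z. rep113 (ternary a b' b (b * k + d) f (f * k + e) x y z))
          \<or> (\<forall>x y z. rep122 (ternary a b' b (b * k + d) f (f * k + e) x y z))"
        using IH a A' unfolding A'_def by auto
      moreover have "ternary a b c d e f x y z = ternary a b' b (b * k + d) f (f * k + e) x z (y - k * z)" for x y z
        unfolding ternary_def b'_def by (simp add: algebra_simps power2_eq_square)
      ultimately show ?thesis by presburger
    next
      case no2: False
      \<comment> \<open>With \<open>k\<close> chosen by rounding, the square of a is at most A plus
        a quarter of that square.\<close>
      have "3 * a\<^sup>2 \<le> 4 * A"
      proof -
        obtain k where k: "2 * \<bar>f + k * a\<bar> \<le> a" using nearest_multiple a by blast
        have "a \<le> b + 2 * k * f + k\<^sup>2 * a" using no1 by (metis not_less)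
        then have "a * a \<le> a * (b + 2 * k * f + k\<^sup>2 * a)" using a by (simp add: mult_left_mono)
        also have "\<dots> = A + (f + k * a)\<^sup>2" unfolding A_def by (simp add: algebra_simps power2_eq_square)
        finally show ?thesis using square_le_quarter[OF k] by (simp add: power2_eq_square)
      qed
      \<comment> \<open>The same argument for the adjoint form, where the determinant gives the term
        3a.\<close>
      moreover have "A\<^sup>2 \<le> 4 * a"
      proof -
        obtain k where k: "2 * \<bar>B + k * A\<bar> \<le> A" using nearest_multiple A0 by blast
        have "A \<le> a * (b * k\<^sup>2 + 2 * d * k + c) - (f * k + e)\<^sup>2" using no2 by (metis not_less)
        then have "A * A \<le> A * (a * (b * k\<^sup>2 + 2 * d * k + c) - (f * k + e)\<^sup>2)" using A0 by (simp add: mult_left_mono)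
        also have "\<dots> = a * ternary_det a b c d e f + (B + k * A)\<^sup>2"
          unfolding A_def B_def ternary_det_def by (simp add: algebra_simps power2_eq_square)
        finally show ?thesis using square_le_quarter[OF k] det by (simp add: power2_eq_square)
      qed
      ultimately have a1: "a = 1"
      proof -
        assume *: "3 * a\<^sup>2 \<le> 4 * A" "A\<^sup>2 \<le> 4 * a"
        show "a = 1"
        proof (rule ccontr)
          assume "a \<noteq> 1"
          then have "2 * a \<le> a\<^sup>2" using a by (simp add: power2_eq_square)
          then have "3 * a \<le> 2 * A" using * by linarith
          then have "(3 * a)\<^sup>2 \<le> (2 * A)\<^sup>2" using a by (intro power_mono) auto
          then have "9 * a\<^sup>2 \<le> 16 * a" using * by (simp add: power_mult_distrib)
          then show False using \<open>2 * a \<le> a\<^sup>2\<close> a by linarith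
        qed
      qed
      have "A \<le> 2"
        using power_strict_mono[of 2 A 2] \<open>A\<^sup>2 \<le> 4 * a\<close> a1 by (cases "A \<le> 2") auto
      define C where "C = c - e\<^sup>2"
      have AB: "A = b - f\<^sup>2" "B = d - e * f" unfolding A_def B_def a1 by auto
      have AC: "A * C = 3 + B\<^sup>2" using det unfolding AB C_def ternary_det_def a1 by (simp add: algebra_simps power2_eq_square)
      \<comment> \<open>Completing the square in x splits off a binary form of determinant 3 with
        leading coefficient \<open>A\<close>.\<close>
      have T: "ternary a b c d e f x y z = (x + f * y + e * z)\<^sup>2 + (A * y\<^sup>2 + 2 * B * y * z + C * z\<^sup>2)" for x y z
        unfolding ternary_def AB C_def a1 by (simp add: algebra_simps power2_eq_square)
      consider "A = 1" | "A = 2" using A0 \<open>A \<le> 2\<close> by linarith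
      then show ?thesis
      proof cases
        case 1
        then have C: "C = 3 + B\<^sup>2" using AC by simp
        have "ternary a b c d e f x y z = (x + f * y + e * z)\<^sup>2 + (y + B * z)\<^sup>2 + 3 * z\<^sup>2" for x y z
          unfolding T C 1 by (simp add: algebra_simps power2_eq_square)
        then show ?thesis unfolding rep113_def by blast
      next
        case 2
        have "odd B"
        proof
          assume "even B"
          then have "even (B\<^sup>2)" by simp
          moreover have "even (3 + B\<^sup>2)" using AC[symmetric] 2 by simp
          ultimately show False by simp
        qed
        then obtain m where m: "B = 2 * m + 1" by (rule oddE)
        have C: "C = 2 * m\<^sup>2 + 2 * m + 2" using AC unfolding m 2 by (simp add: algebra_simps power2_eq_square)
        have "ternary a b c d e f x y z = (x + f * y + e * z)\<^sup>2 + 2 * (y + m * z)\<^sup>2 + 2 * (y + m * z) * z + 2 * z\<^sup>2" for x y z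
          unfolding T C 2 m by (simp add: algebra_simps power2_eq_square)
        then show ?thesis unfolding rep122_def by blast
      qed
    qed
  qed
qed

section \<open>Numbers represented by u^2 + v^2 + 3w^2\<close>

lemma odd_square_obtain:
  fixes u :: int
  assumes "odd u"
  obtains j where "u\<^sup>2 = 8 * j + 1"
proof -
  obtain k where "u = 2 * k + 1" using assms by (rule oddE)
  then have "u\<^sup>2 = 4 * (k * (k + 1)) + 1" by (simp add: algebra_simps power2_eq_square)
  moreover have "even (k * (k + 1))" by simp
  then obtain j where "k * (k + 1) = 2 * j" by (rule evenE)
  ultimately have "u\<^sup>2 = 8 * j + 1" by simp
  then show ?thesis by (rule that)
qed

text \<open>Write n as u^2 + 2m. A value 5 modulo 8 forces m to be 2 modulo 4, but v^2 + vw + w^2 is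
  even only if v and w are, and then 4 divides it.\<close>

lemma rep122_not_5_mod_8: "rep122 n \<Longrightarrow> n mod 8 \<noteq> 5"
proof
  assume "rep122 n" "n mod 8 = 5"
  then obtain u v w where n: "n = u\<^sup>2 + 2 * v\<^sup>2 + 2 * v * w + 2 * w\<^sup>2" unfolding rep122_def by blast
  define m where "m = v\<^sup>2 + v * w + w\<^sup>2"
  have num: "n = u\<^sup>2 + 2 * m" unfolding n m_def by (simp add: algebra_simps)
  have "odd n" using \<open>n mod 8 = 5\<close> by presburger
  then have "odd u" unfolding num by simp
  then obtain j where "u\<^sup>2 = 8 * j + 1" by (rule odd_square_obtain)
  then have "u\<^sup>2 mod 8 = 1" by presburger
  then have m: "m mod 4 = 2" using num \<open>n mod 8 = 5\<close> by presburger
  then have "even m" by presburger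
  then have "even v" "even w" unfolding m_def by auto
  then have "4 dvd m" unfolding m_def by (auto simp: power2_eq_square elim!: evenE)
  then show False using m by presburger
qed

lemma rep113_if_residue:
  assumes "q > 0" "b > 0" "b * N = h\<^sup>2 * q + 3" "q dvd b + t\<^sup>2" "q mod 8 = 5"
  shows "rep113 N"
proof -
  \<comment> \<open>The form with matrix ((a, t, h), (t, q, 0), (h, 0, N)) has determinant bN - h^2 q.\<close>
  obtain a where a: "b + t\<^sup>2 = q * a" using assms(4) by blast
  have "q * a > 0" using a assms(2) zero_le_power2[of t] by linarith
  then have a0: "a > 0" using assms(1) by (simp add: zero_less_mult_iff)
  have A0: "a * q - t\<^sup>2 > 0" using a assms(2) by (simp add: algebra_simps)
  have "ternary_det a q N 0 h t = N * (q * a - t\<^sup>2) - h\<^sup>2 * q"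
    unfolding ternary_det_def by (simp add: algebra_simps)
  moreover have "q * a - t\<^sup>2 = b" using a by simp
  ultimately have "ternary_det a q N 0 h t = 3" using assms(3) by (simp add: mult.commute)
  then have "(\<forall>x y z. rep113 (ternary a q N 0 h t x y z)) \<or> (\<forall>x y z. rep122 (ternary a q N 0 h t x y z))"
    using ternary_det_3_represented a0 A0 by blast
  \<comment> \<open>The form takes the value \<open>q\<close> at the second basis vector, which
    excludes \<open>rep122\<close>, and \<open>N\<close> at the third.\<close>
  moreover have "ternary a q N 0 h t 0 1 0 = q" "ternary a q N 0 h t 0 0 1 = N" unfolding ternary_def by auto
  ultimately show ?thesis using rep122_not_5_mod_8 assms(5) by metis
qed

text \<open>Chinese remaindering over the distinct prime factors.\<close>

lemma squarefree_minus_QuadRes: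
  fixes b :: int and q :: nat
  assumes "squarefree q" "\<And>p. prime p \<Longrightarrow> p dvd q \<Longrightarrow> \<exists>t. int p dvd b + t\<^sup>2"
  shows "\<exists>t. int q dvd b + t\<^sup>2"
  using assms
proof (induction q rule: less_induct)
  case (less q)
  have "q \<noteq> 0" using less.prems(1) by (intro notI) simp
  show ?case
  proof (cases "q = 1")
    case False
    then obtain p where p: "prime p" "p dvd q" using prime_factor_nat by blast
    then obtain m where m: "q = p * m" by blast
    have "m < q" using m \<open>q \<noteq> 0\<close> prime_gt_1_nat[OF p(1)] by simp
    moreover have "squarefree m" using less.prems(1) squarefree_mono[of m q] m by simp
    ultimately obtain t where t: "int m dvd b + t\<^sup>2"
      using less.IH[of m] less.prems(2) m by auto
    obtain u where u: "int p dvd b + u\<^sup>2" using less.prems(2) p by blast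
    have "\<not> p dvd m" using less.prems(1) p(1) unfolding m squarefree_def
      by (metis dvd_triv_left mult_dvd_mono dvd_refl not_prime_unit power2_eq_square)
    then have cop: "coprime (int p) (int m)" using p(1) prime_imp_coprime by simp
    then obtain x where x: "[x = u] (mod p)" "[x = t] (mod m)"
      using binary_chinese_remainder_int by blast
    have "[b + x\<^sup>2 = b + u\<^sup>2] (mod p)" "[b + x\<^sup>2 = b + t\<^sup>2] (mod m)"
      by (intro cong_add cong_pow cong_refl x)+
    then have "int p dvd b + x\<^sup>2" "int m dvd b + x\<^sup>2" using t u cong_dvd_iff by blast+
    then have "int q dvd b + x\<^sup>2" using cop unfolding m by (simp add: divides_mult)
    then show ?thesis by blast
  qed auto
qed

text \<open>The class \<open>c\<close> is chosen so that \<open>q\<close> is 5 modulo 8 and -3 times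
  a square modulo \<open>n\<close>. The conditions on \<open>n\<close> modulo 3 are what gives the
  character (-3N/.) the value 1 at \<open>c\<close>.\<close>

lemma rep113_of_coprime_3:
  assumes n: "n > 0" "\<not> 3 dvd n"
    and N: "N = n \<and> n mod 3 = 2 \<or> N = 3 * n \<and> n mod 3 = 1"
  shows "rep113 (int N)"
proof -
  define M where "M = 24 * n"
  have M: "M > 0" "8 * n dvd M" "even M" "4 dvd M" "4 * 3 dvd M" "8 dvd M" "3 dvd M" "n dvd M"
    unfolding M_def using n(1) by (auto intro: dvd_mult2)
  obtain f where f: "kronecker_char M (int n) f"
    "\<And>c. coprime c M \<Longrightarrow> 8 * n dvd c + 3 \<Longrightarrow> f c = Legendre (int n) 3"
    using kronecker_char_exists[OF n M(2,1)] by blast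
  define \<chi>4 :: "nat \<Rightarrow> int" where "\<chi>4 = (\<lambda>m. if coprime m M then (if m mod 4 = 1 then 1 else - 1) else 0)"
  define \<chi>3 :: "nat \<Rightarrow> int" where "\<chi>3 = (\<lambda>m. if coprime m M then Legendre (int m) (int 3) * (if 3 mod 4 = (3 :: nat) \<and> m mod 4 = 3 then - 1 else 1) else 0)"
  have \<chi>4: "kronecker_char M (- 1) \<chi>4" unfolding \<chi>4_def by (rule kronecker_char_minus_1[OF M(1,4)])
  have \<chi>3: "kronecker_char M 3 \<chi>3" unfolding \<chi>3_def using kronecker_char_odd_prime[OF M(1,5)] by simp
  \<comment> \<open>The number \<open>8 * n - 3\<close> stands for -3; no truncation occurs because
    \<open>n\<close> is positive.\<close>
  obtain c :: nat where c: "[c = 8 * n - 3] (mod 8 * n)" "[c = 2] (mod 3)"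
  proof -
    have "\<not> 3 dvd 8 * n" using n(2) prime_dvd_mult_iff[of 3 8 n] by simp
    then have "coprime 3 (8 * n)" by (intro prime_imp_coprime) simp_all
    then have "coprime (8 * n) 3" by (rule coprime_commute[THEN iffD1])
    then show ?thesis using that binary_chinese_remainder_nat by blast
  qed
  have c3: "c mod 3 = 2" using c(2) by (simp add: cong_def)
  have "[c + 3 = 8 * n - 3 + 3] (mod 8 * n)" using c(1) by (intro cong_add cong_refl)
  then have c8n: "8 * n dvd c + 3" using n(1) by (simp add: cong_dvd_iff)
  then have c8: "8 dvd c + 3" by (rule dvd_mult_left)
  have copc: "coprime c M"
  proof (rule ccontr)
    assume "\<not> coprime c M"
    then have "gcd c M \<noteq> 1" by (simp only: coprime_iff_gcd_eq_1 not_False_eq_True)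
    then obtain p where "prime p" "p dvd gcd c M" using prime_factor_nat by blast
    then have p: "prime p" "p dvd c" "p dvd M" by simp_all
    show False
    proof (cases "p = 3")
      case True
      then show False using p(2) c3 by presburger
    next
      case False
      have "p dvd 3 * (8 * n)" using p(3) unfolding M_def by simp
      then have "p dvd 3 \<or> p dvd 8 * n" using p(1) prime_dvd_mult_iff by blast
      moreover have "\<not> p dvd 3" using False primes_dvd_imp_eq[OF p(1), of 3] by auto
      ultimately have "p dvd 8 * n" by blast
      then have "p dvd c + 3" using c8n by (rule dvd_trans)
      then show False using \<open>\<not> p dvd 3\<close> dvd_add_right_iff[OF p(2), of 3] by blast
    qed
  qed
  have c_vals: "\<chi>4 c = 1" "\<chi>3 c = - 1" "f c = (if n mod 3 = 1 then 1 else - 1)"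
  proof -
    have "c mod 4 = 1" using c8 by presburger
    then show "\<chi>4 c = 1" "\<chi>3 c = - 1" unfolding \<chi>4_def \<chi>3_def using copc Legendre_3[of c] c3 by auto
    have "n mod 3 \<noteq> 0" using n(2) by (simp add: dvd_eq_mod_eq_0)
    then show "f c = (if n mod 3 = 1 then 1 else - 1)" using f(2)[OF copc c8n] Legendre_3[of n] by simp
  qed
  obtain \<chi> where \<chi>: "kronecker_char M (- 3 * int N) \<chi>" "\<chi> c = 1"
    using N
  proof
    assume N: "N = n \<and> n mod 3 = 2"
    have "kronecker_char M ((- 1) * 3 * n) (\<lambda>m. \<chi>4 m * \<chi>3 m * f m)"
      by (intro kronecker_char_mult M(3) \<chi>4 \<chi>3 f(1))
    then show thesis using that N c_vals by simp
  next
    assume N: "N = 3 * n \<and> n mod 3 = 1"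
    have "kronecker_char M ((- 1) * 3 * (3 * int n)) (\<lambda>m. \<chi>4 m * \<chi>3 m * (\<chi>3 m * f m))"
      by (intro kronecker_char_mult M(3) \<chi>4 \<chi>3 f(1))
    then show thesis using that N c_vals by simp
  qed
  then obtain q s where q: "squarefree q" "\<And>p. prime p \<Longrightarrow> p dvd q \<Longrightarrow> \<chi> p = 1"
    "coprime s M" "[q = c * s\<^sup>2] (mod M)"
    using rchar_split_primes_represent[of M \<chi> c] unfolding kronecker_char_def by metis
  have "q > 0" using q(1) by (auto intro!: Nat.gr0I)
  have q8: "int q mod 8 = 5"
  proof -
    have "odd (int s)" using odd_of_coprime[OF M(3) q(3)] by simp
    then obtain j where j: "(int s)\<^sup>2 = 8 * j + 1" by (rule odd_square_obtain)
    have "[q = c * s\<^sup>2] (mod 8)" using cong_dvd_modulus_nat[OF q(4) M(6)] .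
    then have "int q mod 8 = int (c * s\<^sup>2) mod 8" unfolding cong_def by (metis of_nat_mod of_nat_numeral)
    also have "int (c * s\<^sup>2) = int c + 8 * (int c * j)" using j by (simp add: algebra_simps)
    also have "\<dots> mod 8 = int c mod 8" by simp
    also have "\<dots> = 5" using c8 by presburger
    finally show ?thesis .
  qed
  have q_n: "[int q = - 3 * (int s)\<^sup>2] (mod n)"
  proof -
    have "[int q = int c * (int s)\<^sup>2] (mod n)"
      using cong_dvd_modulus_nat[OF q(4) M(8)] by (metis cong_int_iff of_nat_mult of_nat_power)
    also have "n dvd c + 3" using c8n by (rule dvd_mult_right)
    then have "int n dvd int c - (- 3)" by (metis diff_minus_eq_add of_nat_add of_nat_dvd_iff of_nat_numeral)
    then have "[int c = - 3] (mod n)" by (simp add: cong_iff_dvd_diff)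
    then have "[int c * (int s)\<^sup>2 = - 3 * (int s)\<^sup>2] (mod n)" by (intro cong_mult cong_refl)
    finally show ?thesis .
  qed
  \<comment> \<open>With \<open>h\<close> inverse to 3s, the number 3 h^2 q is -(3sh)^2, that is -1,
    modulo \<open>n\<close>. Tripling 3 h^2 q + 1 yields the divisibility by
    \<open>N\<close>.\<close>
  obtain h where h: "[3 * int s * h = 1] (mod n)"
  proof -
    have "coprime (3 * s) n" using n(2) prime_imp_coprime[of 3 n] coprime_of_dvd_modulus[OF M(8) q(3)] by simp
    then have "coprime (3 * int s) (int n)" by (metis coprime_int_iff of_nat_mult of_nat_numeral)
    then show ?thesis using that cong_solve_coprime_int by blast
  qed
  have "[3 * h\<^sup>2 * int q + 1 = 3 * h\<^sup>2 * (- 3 * (int s)\<^sup>2) + 1] (mod n)"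
    by (intro cong_add cong_mult cong_refl q_n)
  also have "3 * h\<^sup>2 * (- 3 * (int s)\<^sup>2) + 1 = 1 - (3 * int s * h)\<^sup>2" by (simp add: power_mult_distrib)
  also have "[1 - (3 * int s * h)\<^sup>2 = 1 - 1\<^sup>2] (mod n)" by (intro cong_diff cong_pow cong_refl h)
  finally have "int n dvd 3 * h\<^sup>2 * int q + 1" by (simp add: cong_0_iff)
  then have "3 * int n dvd 3 * (3 * h\<^sup>2 * int q + 1)" by (rule mult_dvd_mono[OF dvd_refl])
  moreover have "int N dvd 3 * int n" using N by auto
  ultimately have "int N dvd (3 * h)\<^sup>2 * int q + 3" by (auto simp: power_mult_distrib algebra_simps intro: dvd_trans)
  then obtain b where b: "b * int N = (3 * h)\<^sup>2 * int q + 3" by (metis dvdE mult.commute)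
  have "b * int N > 0" using b by (simp add: add_nonneg_pos)
  then have "b > 0" by (simp add: zero_less_mult_iff)
  have "\<exists>t. int p dvd b + t\<^sup>2" if p: "prime p" "p dvd q" for p
  proof -
    have "\<chi> p = 1" using q(2) p by blast
    then have "coprime p M" using \<chi>(1) rchar_nonzero_iff[of M \<chi> p] unfolding kronecker_char_def by simp
    then have "Legendre (- 3 * int N) p = 1" using \<chi>(1) p(1) \<open>\<chi> p = 1\<close> unfolding kronecker_char_def by metis
    then obtain y where y: "[y\<^sup>2 = - 3 * int N] (mod p)" unfolding Legendre_def QuadRes_def by (auto split: if_splits)
    have "coprime 3 p" using coprime_of_dvd_modulus[OF M(7) \<open>coprime p M\<close>] by (rule coprime_commute[THEN iffD1])
    then have "coprime (int 3) (int p)" by (simp only: coprime_int_iff)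
    then obtain r :: int where r: "[3 * r = 1] (mod p)" using cong_solve_coprime_int[of "int 3" "int p"] by auto
    have "int p dvd int q" using p by simp
    then have "[(3 * h)\<^sup>2 * int q + 3 = (3 * h)\<^sup>2 * 0 + 3] (mod p)" by (intro cong_add cong_mult cong_refl) (simp add: cong_0_iff)
    then have bN: "[b * int N = 3] (mod p)" using b by simp
    \<comment> \<open>Since y^2 is -3N, bN is 3 and 3r is 1 modulo \<open>p\<close>, the square of y
      b r is -b.\<close>
    have "[(y * b * r)\<^sup>2 = y\<^sup>2 * b\<^sup>2 * r\<^sup>2] (mod p)" by (simp add: power_mult_distrib)
    also have "[y\<^sup>2 * b\<^sup>2 * r\<^sup>2 = (- 3 * int N) * b\<^sup>2 * r\<^sup>2] (mod p)" by (intro cong_mult cong_refl y)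
    also have "(- 3 * int N) * b\<^sup>2 * r\<^sup>2 = - 3 * b * r\<^sup>2 * (b * int N)" by (simp add: power2_eq_square)
    also have "[- 3 * b * r\<^sup>2 * (b * int N) = - 3 * b * r\<^sup>2 * 3] (mod p)" by (intro cong_mult cong_refl bN)
    also have "- 3 * b * r\<^sup>2 * 3 = - b * (3 * r)\<^sup>2" by (simp add: power_mult_distrib)
    also have "[- b * (3 * r)\<^sup>2 = - b * 1\<^sup>2] (mod p)" by (intro cong_mult cong_pow cong_refl r)
    finally have "int p dvd b + (y * b * r)\<^sup>2" by (simp add: cong_iff_dvd_diff add.commute)
    then show ?thesis by blast
  qed
  then obtain t where t: "int q dvd b + t\<^sup>2" using squarefree_minus_QuadRes[OF q(1)] by blast
  show ?thesis
    by (rule rep113_if_residue[OF _ \<open>b > 0\<close> b t q8]) (use \<open>q > 0\<close> in simp)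
qed

lemma rep113_of_mod_3:
  assumes "n > 0" "n mod 3 = 2 \<or> n mod 9 = 3"
  shows "rep113 n"
proof (cases "n mod 3 = 2")
  case True
  then have "nat n mod 3 = 2" using assms(1) nat_mod_distrib[of n 3] by simp
  then show ?thesis using rep113_of_coprime_3[of "nat n" "nat n"] assms(1) by (auto simp: dvd_eq_mod_eq_0)
next
  case False
  define m where "m = n div 3"
  have m: "n = 3 * m" "m mod 3 = 1" unfolding m_def using False assms(2) by presburger+
  have m0: "m > 0" "nat m mod 3 = 1" using m assms(1) nat_mod_distrib[of m 3] by simp_all
  then show ?thesis using rep113_of_coprime_3[of "nat m" "3 * nat m"] m(1) m0 by (auto simp: dvd_eq_mod_eq_0)
qed

section \<open>From a representation of 6A - B^2 to w, x, y, z, and the window for B\<close>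

section \<open>The choice of A and B\<close>

lemma square_mod_3: "(u::int)\<^sup>2 mod 3 = (if 3 dvd u then 0 else 1)"
proof (cases "3 dvd u")
  case True
  then obtain k where "u = 3 * k" by blast
  then have "u\<^sup>2 = 3 * (3 * k\<^sup>2)" by (simp add: power_mult_distrib)
  then show ?thesis using True by simp
next
  case False
  then have "u mod 3 = 1 \<or> u mod 3 = 2" by presburger
  then have "(u mod 3)\<^sup>2 mod 3 = 1" by auto
  then show ?thesis using False by (simp add: power_mod)
qed

lemma square_mod_4: "(u::int)\<^sup>2 mod 4 = (if even u then 0 else 1)"
proof (cases "even u")
  case True
  then obtain k where "u = 2 * k" by blast
  then have "u\<^sup>2 = 4 * k\<^sup>2" by (simp add: power_mult_distrib)
  then show ?thesis using True by simp
next
  case False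
  then have "u mod 4 = 1 \<or> u mod 4 = 3" by presburger
  then have "(u mod 4)\<^sup>2 mod 4 = 1" by auto
  then show ?thesis using False by (simp add: power_mod)
qed

text \<open>Swapping u and v and changing signs suffices to make the later divisions by 6, 3 and 2
  exact: modulo 4, one of u, v has the parity of B and the other that of t; modulo 3, either all of
  B, u, v vanish or none does.\<close>

lemma normalise_rep113:
  fixes A B :: int
  assumes D: "6 * A - B\<^sup>2 = u\<^sup>2 + v\<^sup>2 + 3 * t\<^sup>2" and par: "even (A - B)"
    and mod3: "\<not> 3 dvd B \<or> 3 dvd u \<and> 3 dvd v"
  obtains u v t where "6 * A - B\<^sup>2 = u\<^sup>2 + v\<^sup>2 + 3 * t\<^sup>2" "6 dvd B - u" "3 dvd u + v" "even (v - t)"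
proof -
  have *: "even (u - B) \<and> even (v - t) \<or> even (v - B) \<and> even (u - t)"
  proof -
    have parity: "even (u - B) \<and> even (v - t) \<or> even (v - B) \<and> even (u - t)"
      if "6 * A = b + x + y + 3 * z" "b mod 4 = (if even B then 0 else 1)" "x mod 4 = (if even u then 0 else 1)"
        "y mod 4 = (if even v then 0 else 1)" "z mod 4 = (if even t then 0 else 1)" for b x y z :: int
    proof -
      have A4: "6 * A mod 4 = (if even B then 0 else 2)"
      proof (cases "even B")
        case True
        then have "even A" using par by simp
        then show ?thesis using True by presburger
      next
        case False
        then have "odd A" using par by simp
        then have "6 * A mod 4 = 2" by presburger
        then show ?thesis using False by simp
      qed
      have "[b mod 4 + x mod 4 + y mod 4 + 3 * (z mod 4) = b + x + y + 3 * z] (mod 4)"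
        by (intro cong_add cong_mult cong_refl) simp_all
      then have "(b mod 4 + x mod 4 + y mod 4 + 3 * (z mod 4)) mod 4 = (b + x + y + 3 * z) mod 4"
        unfolding cong_def .
      also have "\<dots> = (if even B then 0 else 2)" using A4 by (simp only: that(1))
      finally have "(b mod 4 + x mod 4 + y mod 4 + 3 * (z mod 4)) mod 4 = (if even B then 0 else 2)" .
      then show ?thesis unfolding that(2-5)
        by (cases "even B"; cases "even u"; cases "even v"; cases "even t") simp_all
    qed
    show ?thesis using D by (intro parity[of "B\<^sup>2" "u\<^sup>2" "v\<^sup>2" "t\<^sup>2"] square_mod_4) simp
  qed
  define u1 where "u1 = (if even (u - B) \<and> even (v - t) then u else v)"
  define v1 where "v1 = (if even (u - B) \<and> even (v - t) then v else u)"
  have 1: "6 * A - B\<^sup>2 = u1\<^sup>2 + v1\<^sup>2 + 3 * t\<^sup>2" "even (u1 - B)" "even (v1 - t)"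
    "\<not> 3 dvd B \<or> 3 dvd u1 \<and> 3 dvd v1"
    using * D mod3 unfolding u1_def v1_def by auto
  have nz: "3 dvd B \<and> 3 dvd u1 \<and> 3 dvd v1 \<or> \<not> 3 dvd B \<and> \<not> 3 dvd u1 \<and> \<not> 3 dvd v1"
  proof -
    have "B\<^sup>2 + u1\<^sup>2 + v1\<^sup>2 = 3 * (2 * A - t\<^sup>2)" using 1(1) by simp
    then have "(B\<^sup>2 + u1\<^sup>2 + v1\<^sup>2) mod 3 = 0" by (metis mod_mult_self1_is_0)
    moreover have "[B\<^sup>2 mod 3 + u1\<^sup>2 mod 3 + v1\<^sup>2 mod 3 = B\<^sup>2 + u1\<^sup>2 + v1\<^sup>2] (mod 3)"
      by (intro cong_add) simp_all
    ultimately have "(B\<^sup>2 mod 3 + u1\<^sup>2 mod 3 + v1\<^sup>2 mod 3) mod 3 = 0" unfolding cong_def by metis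
    then show ?thesis using 1(4) unfolding square_mod_3 by (auto split: if_splits)
  qed
  define u2 where "u2 = (if 3 dvd B - u1 then u1 else - u1)"
  have u2: "3 dvd B - u2" "u2\<^sup>2 = u1\<^sup>2" "even (B - u2)" using nz 1(2) unfolding u2_def by auto presburger+
  define v2 where "v2 = (if 3 dvd u2 + v1 then v1 else - v1)"
  have "3 dvd u2 + v2" using nz unfolding v2_def u2_def by auto presburger+
  moreover have "v2\<^sup>2 = v1\<^sup>2" "even (v2 - t)" using 1(3) unfolding v2_def by auto
  moreover have "6 dvd B - u2" using u2 by presburger
  ultimately show ?thesis using that[of u2 v2 t] 1(1) u2(2) by simp
qed

text \<open>Six times each unknown is B + e for a linear form e in u, v, t with e^2 <= 5D. The upper
  bound says 5D < (B + 6)^2, so B + e > -6, and divisibility by 6 makes the unknown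
  nonnegative.\<close>

lemma weighted_four_squares:
  fixes A B :: int
  assumes par: "even (A - B)" and mod3: "\<not> 3 dvd B \<or> A mod 3 = 2"
    and lower: "B\<^sup>2 \<le> 6 * A" and upper: "5 * A < B\<^sup>2 + 2 * B + 6" and B: "B \<ge> 0"
  shows "\<exists>w x y z :: nat. 3 * (int w)\<^sup>2 + (int x)\<^sup>2 + (int y)\<^sup>2 + (int z)\<^sup>2 = A
    \<and> 3 * int w + int x + int y + int z = B"
proof -
  define D where "D = 6 * A - B\<^sup>2"
  have D3: "if 3 dvd B then D mod 9 = 3 else D mod 3 = 2"
  proof (cases "3 dvd B")
    case True
    then obtain k where "B = 3 * k" by blast
    then have "D = 6 * A - 9 * k\<^sup>2" unfolding D_def by (simp add: power_mult_distrib)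
    then show ?thesis using True mod3 by presburger
  next
    case False
    then have "B\<^sup>2 mod 3 = 1" by (simp add: square_mod_3)
    then show ?thesis using False unfolding D_def by presburger
  qed
  have "D \<ge> 0" using lower unfolding D_def by simp
  moreover have "D \<noteq> 0" using D3 by (auto split: if_splits)
  ultimately have "rep113 D" using rep113_of_mod_3[of D] D3 by (auto split: if_splits)
  then obtain u v t where uvt: "6 * A - B\<^sup>2 = u\<^sup>2 + v\<^sup>2 + 3 * t\<^sup>2" unfolding rep113_def D_def by blast
  have "\<not> 3 dvd B \<or> 3 dvd u \<and> 3 dvd v"
  proof (cases "3 dvd B")
    case True
    then have "D mod 3 = 0" using D3 by presburger
    moreover have "[u\<^sup>2 mod 3 + v\<^sup>2 mod 3 = u\<^sup>2 + v\<^sup>2] (mod 3)" by (intro cong_add) simp_all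
    moreover have "D mod 3 = (u\<^sup>2 + v\<^sup>2) mod 3" unfolding D_def uvt by simp
    ultimately have "(u\<^sup>2 mod 3 + v\<^sup>2 mod 3) mod 3 = 0" unfolding cong_def by metis
    then show ?thesis unfolding square_mod_3 by (auto split: if_splits)
  qed simp
  from normalise_rep113[OF uvt par this]
  obtain u v t where uvt: "6 * A - B\<^sup>2 = u\<^sup>2 + v\<^sup>2 + 3 * t\<^sup>2" and "6 dvd B - u" "3 dvd u + v" "even (v - t)"
    by metis
  \<comment> \<open>The unknowns will be w, x = w + p, y = w + g and z = w + g - t.\<close>
  then obtain w p where w: "B - u = 6 * w" and p: "u + v = 3 * p" by blast
  have "even (u - p + t)" using p \<open>even (v - t)\<close> by presburger
  then obtain g where g: "u - p + t = 2 * g" by blast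
  have eqs: "B = 6 * w + u" "v = 3 * p - u" "t = 2 * g - u + p" using w p g by auto
  have bound: "- 6 < B + e" if "5 * D = e\<^sup>2 + r" "0 \<le> r" for e r
  proof -
    have "5 * D < (B + 6)\<^sup>2" using upper unfolding D_def by (simp add: power2_eq_square algebra_simps)
    then have "e\<^sup>2 < (B + 6)\<^sup>2" using that by simp
    then have "\<bar>e\<bar> < B + 6" using B by (metis abs_of_nonneg abs_square_less_1 add_nonneg_nonneg power2_less_imp_less power2_abs zero_le_numeral)
    then show ?thesis by linarith
  qed
  have D': "D = u\<^sup>2 + v\<^sup>2 + 3 * t\<^sup>2" using uvt unfolding D_def .
  \<comment> \<open>The four forms e for w, x, y, z; each time 5D - e^2 is displayed as a sum of
    squares.\<close>
  have "- 6 < B + (- u)"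
    by (rule bound[of _ "4 * u\<^sup>2 + 5 * v\<^sup>2 + 15 * t\<^sup>2"]) (simp_all add: D')
  moreover have "- 6 < B + (u + 2 * v)"
    by (rule bound[of _ "(2 * u - v)\<^sup>2 + 15 * t\<^sup>2"]) (simp add: D' power2_eq_square algebra_simps, simp)
  moreover have "- 6 < B + (u - v + 3 * t)"
    by (rule bound[of _ "(u + v)\<^sup>2 + 3 * (u - t)\<^sup>2 + 3 * (v + t)\<^sup>2"])
      (simp add: D' power2_eq_square algebra_simps, simp)
  moreover have "- 6 < B + (u - v - 3 * t)"
    by (rule bound[of _ "(u + v)\<^sup>2 + 3 * (u + t)\<^sup>2 + 3 * (v - t)\<^sup>2"])
      (simp add: D' power2_eq_square algebra_simps, simp)
  ultimately have nonneg: "0 \<le> w" "0 \<le> w + p" "0 \<le> w + g" "0 \<le> w + g - t"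
    using eqs by presburger+
  have "6 * (3 * w\<^sup>2 + (w + p)\<^sup>2 + (w + g)\<^sup>2 + (w + g - t)\<^sup>2) = B\<^sup>2 + (u\<^sup>2 + v\<^sup>2 + 3 * t\<^sup>2)"
    unfolding eqs by (simp add: power2_eq_square algebra_simps)
  also have "\<dots> = 6 * A" unfolding uvt[symmetric] by simp
  finally have "3 * w\<^sup>2 + (w + p)\<^sup>2 + (w + g)\<^sup>2 + (w + g - t)\<^sup>2 = A" by (simp only: mult_cancel_left) simp
  moreover have "3 * w + (w + p) + (w + g) + (w + g - t) = B" unfolding eqs by simp
  ultimately show ?thesis using nonneg
    by (intro exI[of _ "nat w"] exI[of _ "nat (w + p)"] exI[of _ "nat (w + g)"] exI[of _ "nat (w + g - t)"]) simp
qed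

text \<open>All solutions arise by moving (A, B) along (-b, a). Parity and the condition modulo 3
  are adjusted separately and then combined.\<close>

lemma residue_class_exists:
  fixes a b n :: int
  assumes "gcd a b = 1" "even (a * b) \<or> even n"
  obtains A B where "a * A + b * B = n" "even (A - B)" "\<not> 3 dvd B \<or> A mod 3 = 2"
proof -
  obtain x y where "x * a + y * b = 1" using bezout_int[of a b] assms(1) by metis
  then have "a * (x * n) + b * (y * n) = n" by (metis mult.assoc mult.commute distrib_right mult_1)
  then obtain A B where AB: "a * A + b * B = n" by blast
  have ndvd: "\<not> (k dvd a \<and> k dvd b)" if "\<not> is_unit k" for k
    using that assms(1) by (metis gcd_greatest)
  obtain i where i: "even ((A - b * i) - (B + a * i))"
  proof (cases "even (A - B)")
    case True
    then show ?thesis using that[of 0] by simp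
  next
    case False
    \<comment> \<open>A single step changes the parity of A - B when a + b is odd. Otherwise a and b
      are both odd, so n is even and A - B was even already.\<close>
    have "odd (a + b)"
    proof
      assume "even (a + b)"
      then have "odd a" "odd b" using ndvd[of 2] by auto
      then show False using assms(2) AB False by auto
    qed
    then show ?thesis using that[of 1] False by auto
  qed
  obtain j where j: "\<not> 3 dvd B + a * j \<or> (A - b * j) mod 3 = 2"
  proof (cases "3 dvd a")
    case True
    then have "\<not> 3 dvd b" using ndvd[of 3] by auto
    then have "b mod 3 = 1 \<or> b mod 3 = 2" by presburger
    moreover have "A mod 3 = 0 \<or> A mod 3 = 1 \<or> A mod 3 = 2" by presburger
    ultimately have "A mod 3 = 2 \<or> (A - b) mod 3 = 2 \<or> (A - b * 2) mod 3 = 2" by presburger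
    then show ?thesis using that[of 0] that[of 1] that[of 2] by auto
  next
    case False
    then have "\<not> 3 dvd B \<or> \<not> 3 dvd B + a" by presburger
    then show ?thesis using that[of 0] that[of 1] by auto
  qed
  \<comment> \<open>Congruent to \<open>i\<close> modulo 2 and to \<open>j\<close> modulo 3.\<close>
  define k where "k = 3 * i - 2 * j"
  have k: "k = j + 3 * (i - j)" unfolding k_def by simp
  have "a * (A - b * k) + b * (B + a * k) = n" using AB by (simp add: algebra_simps)
  moreover have "even k \<longleftrightarrow> even i" unfolding k_def by simp
  then have "even ((A - b * k) - (B + a * k))" using i by simp
  moreover have "B + a * k = B + a * j + 3 * (a * (i - j))" "A - b * k = A - b * j + 3 * (- b * (i - j))"
    unfolding k by (simp_all add: algebra_simps)
  then have "\<not> 3 dvd B + a * k \<or> (A - b * k) mod 3 = 2" using j by presburger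
  ultimately show ?thesis using that by blast
qed

text \<open>Take the last member of the class before \<open>P\<close> first fails. Failure at the
  next member bounds \<open>n\<close> from above, and the size of \<open>n\<close> forces this
  member to be large enough for the second inequality.\<close>

lemma window_member_exists:
  fixes a b r :: int and n :: nat
  assumes a: "a > 0" and b: "b > - a"
    and n: "real n / 6 >
      66 * (real_of_int a)\<^sup>2 * (9 * real_of_int a - 1) + real_of_int a
      + (33 * real_of_int a - 1) * real_of_int b
      + (2 * real_of_int a * (18 * real_of_int a - 1) + real_of_int b)
        * sqrt (15 * (2 * real_of_int a * (9 * real_of_int a - 1) + real_of_int b))"
  obtains k where "r + 6 * a * k \<ge> 0"
    "a * (r + 6 * a * k)\<^sup>2 + 6 * b * (r + 6 * a * k) \<le> 6 * int n"
    "5 * (int n - b * (r + 6 * a * k)) < a * ((r + 6 * a * k)\<^sup>2 + 2 * (r + 6 * a * k) + 6)"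
proof -
  define \<alpha> \<beta> where "\<alpha> = real_of_int a" and "\<beta> = real_of_int b"
  define R where "R = sqrt (15 * (2 * \<alpha> * (9 * \<alpha> - 1) + \<beta>))"
  \<comment> \<open>Chosen so that \<alpha> S^2 + \<beta> S expands to exactly the lower bound
    assumed for n / 6; hence \<open>P\<close> cannot fail on [0, 6S].\<close>
  define S where "S = 18 * \<alpha> - 1 + R"
  have \<alpha>: "\<alpha> \<ge> 1" and \<beta>: "\<beta> \<ge> 1 - \<alpha>" using a b unfolding \<alpha>_def \<beta>_def by linarith+
  have \<alpha>2: "\<alpha> \<le> \<alpha>\<^sup>2" using \<alpha> by (simp add: power2_eq_square)
  have rad: "2 * \<alpha> * (9 * \<alpha> - 1) + \<beta> = 18 * \<alpha>\<^sup>2 - 2 * \<alpha> + \<beta>"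
    by (simp add: algebra_simps power2_eq_square)
  have "0 \<le> 15 * (18 * \<alpha>\<^sup>2 - 2 * \<alpha> + \<beta>)" using \<alpha>2 \<alpha> \<beta> by simp
  then have R2: "R\<^sup>2 = 15 * (18 * \<alpha>\<^sup>2 - 2 * \<alpha> + \<beta>)" and R0: "R \<ge> 0"
    unfolding R_def rad by simp_all
  have nS: "real n / 6 > \<alpha> * S\<^sup>2 + \<beta> * S"
  proof -
    have "\<alpha> * S\<^sup>2 + \<beta> * S = \<alpha> * (18 * \<alpha> - 1)\<^sup>2 + 2 * \<alpha> * (18 * \<alpha> - 1) * R + \<alpha> * R\<^sup>2 + \<beta> * (18 * \<alpha> - 1) + \<beta> * R"
      unfolding S_def by (simp add: power2_eq_square algebra_simps)
    also have "\<dots> = 66 * \<alpha>\<^sup>2 * (9 * \<alpha> - 1) + \<alpha> + (33 * \<alpha> - 1) * \<beta> + (2 * \<alpha> * (18 * \<alpha> - 1) + \<beta>) * R"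
      unfolding R2 by (simp add: power2_eq_square algebra_simps)
    finally show ?thesis using n unfolding R_def \<alpha>_def \<beta>_def by simp
  qed
  define P where "P B \<longleftrightarrow> a * B\<^sup>2 + 6 * b * B \<le> 6 * int n" for B
  have large: "6 * S < real_of_int B" if "\<not> P B" "B \<ge> 0" for B
  proof (rule ccontr)
    define x where "x = real_of_int B"
    assume "\<not> 6 * S < real_of_int B"
    then have x: "x \<le> 6 * S" "x \<ge> 0" using that unfolding x_def by auto
    have "6 * int n < a * B\<^sup>2 + 6 * b * B" using that unfolding P_def by simp
    then have "real_of_int (6 * int n) < real_of_int (a * B\<^sup>2 + 6 * b * B)" by (simp only: of_int_less_iff)
    then have "6 * real n < \<alpha> * x\<^sup>2 + 6 * \<beta> * x" unfolding \<alpha>_def \<beta>_def x_def by simp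
    then have "36 * (\<alpha> * S\<^sup>2 + \<beta> * S) < \<alpha> * x\<^sup>2 + 6 * \<beta> * x" using nS by simp
    then have "0 < (x - 6 * S) * (\<alpha> * (x + 6 * S) + 6 * \<beta>)" by (simp add: power2_eq_square algebra_simps)
    moreover have "6 * \<alpha> \<le> \<alpha> * (x + 6 * S)"
    proof -
      have "6 \<le> x + 6 * S" using x \<alpha> R0 unfolding S_def by simp
      then show ?thesis using \<alpha> by (simp add: mult.commute[of 6] mult_left_mono)
    qed
    then have "0 \<le> \<alpha> * (x + 6 * S) + 6 * \<beta>" using \<beta> \<alpha> by linarith
    then have "(x - 6 * S) * (\<alpha> * (x + 6 * S) + 6 * \<beta>) \<le> 0" using x by (simp add: mult_nonpos_nonneg)
    ultimately show False by simp
  qed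
  define r0 where "r0 = r mod (6 * a)"
  have r0: "0 \<le> r0" "r0 < 6 * a" unfolding r0_def using a by auto
  have "\<exists>j. \<not> P (r0 + 6 * a * int j)"
  proof
    define B where "B = r0 + 6 * a * int (n + 2)"
    have "6 * a * int (n + 2) \<ge> 6 * int (n + 2)" using a by (intro mult_right_mono) auto
    then have B: "B \<ge> 6 * int n + 12" unfolding B_def using r0 by simp
    have "6 * int n < 1 * (B * 1)" using B by simp
    also have "\<dots> \<le> a * (B * (B - 6))" using a B by (intro mult_mono) auto
    also have "\<dots> \<le> a * B\<^sup>2 + 6 * b * B"
    proof -
      have "(- a) * B \<le> b * B" using b B by (intro mult_right_mono) auto
      then show ?thesis by (simp add: power2_eq_square algebra_simps)
    qed
    finally show "\<not> P (r0 + 6 * a * int (n + 2))" unfolding P_def B_def by simp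
  qed
  define j where "j = (LEAST j. \<not> P (r0 + 6 * a * int j))"
  have j: "\<not> P (r0 + 6 * a * int j)" unfolding j_def by (rule LeastI_ex) fact
  \<comment> \<open>The first member \<open>r0\<close> is below 6a, hence below 6S, so
    \<open>P\<close> holds there and a predecessor exists.\<close>
  have "j \<noteq> 0"
  proof
    assume "j = 0"
    then have "6 * S < real_of_int r0" using large[of r0] j r0 by simp
    moreover have "real_of_int r0 < 6 * \<alpha>" using r0(2) unfolding \<alpha>_def by linarith
    ultimately show False using \<alpha> R0 unfolding S_def by simp
  qed
  then obtain i where i: "j = Suc i" by (cases j) auto
  define B where "B = r0 + 6 * a * int i"
  have PB: "P B" using not_less_Least[of i "\<lambda>j. \<not> P (r0 + 6 * a * int j)"] i unfolding j_def[symmetric] B_def by simp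
  have B0: "B \<ge> 0" unfolding B_def using r0 a by simp
  have notP: "\<not> P (B + 6 * a)" using j unfolding i B_def by (simp add: algebra_simps)
  define x where "x = real_of_int B"
  \<comment> \<open>One step 6 \<alpha> back from 6S turns 18 \<alpha> into 17 \<alpha>.\<close>
  have x: "x > 6 * (17 * \<alpha> - 1 + R)" using large[OF notP] B0 a unfolding S_def x_def \<alpha>_def by simp
  have n6: "6 * real n < \<alpha> * (x + 6 * \<alpha>)\<^sup>2 + 6 * \<beta> * (x + 6 * \<alpha>)"
  proof -
    have "6 * int n < a * (B + 6 * a)\<^sup>2 + 6 * b * (B + 6 * a)" using notP unfolding P_def by simp
    then have "real_of_int (6 * int n) < real_of_int (a * (B + 6 * a)\<^sup>2 + 6 * b * (B + 6 * a))" by (simp only: of_int_less_iff)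
    then show ?thesis unfolding x_def \<alpha>_def \<beta>_def by simp
  qed
  \<comment> \<open>Multiplied by \<alpha>, this is the slack left in six times the goal after
    inserting \<open>n6\<close>. Both x and x - 60 \<alpha> + 12 are at least 6R, and 36 R^2 absorbs
    the remaining terms.\<close>
  have key: "0 \<le> x\<^sup>2 - 60 * \<alpha> * x - 180 * \<alpha>\<^sup>2 + 12 * x + 36 - 180 * \<beta>"
  proof -
    have "(6 * R) * (6 * R) \<le> x * (x - 60 * \<alpha> + 12)"
      using x \<alpha> R0 by (intro mult_mono) auto
    then have "36 * R\<^sup>2 \<le> x * (x - 60 * \<alpha> + 12)" by (simp add: power2_eq_square)
    then have "540 * (18 * \<alpha>\<^sup>2 - 2 * \<alpha> + \<beta>) \<le> x * (x - 60 * \<alpha> + 12)" unfolding R2 by simp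
    also have "\<dots> = x\<^sup>2 - 60 * \<alpha> * x + 12 * x" by (simp add: power2_eq_square algebra_simps)
    finally show ?thesis using \<alpha> \<alpha>2 \<beta> by simp
  qed
  have "5 * (real n - \<beta> * x) < \<alpha> * (x\<^sup>2 + 2 * x + 6)"
  proof -
    have "0 \<le> \<alpha> * (x\<^sup>2 - 60 * \<alpha> * x - 180 * \<alpha>\<^sup>2 + 12 * x + 36 - 180 * \<beta>)" using key \<alpha> by simp
    then show ?thesis using n6 by (simp add: power2_eq_square algebra_simps)
  qed
  then have "real_of_int (5 * (int n - b * B)) < real_of_int (a * (B\<^sup>2 + 2 * B + 6))"
    unfolding x_def \<alpha>_def \<beta>_def by simp
  then have up: "5 * (int n - b * B) < a * (B\<^sup>2 + 2 * B + 6)" by (simp only: of_int_less_iff)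
  define k where "k = int i - r div (6 * a)"
  have "B = r + 6 * a * k"
    unfolding B_def r0_def k_def by (simp add: minus_div_mult_eq_mod[symmetric] algebra_simps)
  then show ?thesis using that[of k] B0 PB up unfolding P_def by simp
qed

theorem theorem5:
  fixes a b :: int and n :: nat
  assumes "a > 0" and "b > - a" and "gcd a b = 1"
    and "even (a * b) \<or> even n"
    and "real n / 6 >
      66 * (real_of_int a)\<^sup>2 * (9 * real_of_int a - 1) + real_of_int a
      + (33 * real_of_int a - 1) * real_of_int b
      + (2 * real_of_int a * (18 * real_of_int a - 1) + real_of_int b)
        * sqrt (15 * (2 * real_of_int a * (9 * real_of_int a - 1) + real_of_int b))"
  shows "\<exists>w x y z :: nat.
      3 * int w * (a * int w + b) + int x * (a * int x + b)
      + int y * (a * int y + b) + int z * (a * int z + b) = int n"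
proof -
  obtain A0 r where r: "a * A0 + b * r = int n" "even (A0 - r)" "\<not> 3 dvd r \<or> A0 mod 3 = 2"
    using residue_class_exists[of a b "int n"] assms(3,4) by (metis even_of_nat)
  obtain k where k: "r + 6 * a * k \<ge> 0"
    "a * (r + 6 * a * k)\<^sup>2 + 6 * b * (r + 6 * a * k) \<le> 6 * int n"
    "5 * (int n - b * (r + 6 * a * k)) < a * ((r + 6 * a * k)\<^sup>2 + 2 * (r + 6 * a * k) + 6)"
    using window_member_exists[OF assms(1,2,5)] by blast
  \<comment> \<open>A shift by a multiple of 6 along the solutions keeps the parity of A - B and the
    residues of A and B modulo 3.\<close>
  define A B where "A = A0 - 6 * b * k" and "B = r + 6 * a * k"
  have AB: "a * A + b * B = int n" using r(1) unfolding A_def B_def by (simp add: algebra_simps)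
  have "even (A - B)" using r(2) unfolding A_def B_def by simp
  moreover have "A = A0 + 3 * (- 2 * b * k)" "B = r + 3 * (2 * a * k)" unfolding A_def B_def by simp_all
  then have "\<not> 3 dvd B \<or> A mod 3 = 2" using r(3) by presburger
  moreover have "a * B\<^sup>2 \<le> a * (6 * A)" using k(2) unfolding B_def[symmetric] AB[symmetric] by (simp add: algebra_simps)
  then have "B\<^sup>2 \<le> 6 * A" using assms(1) by simp
  moreover have "a * (5 * A) < a * (B\<^sup>2 + 2 * B + 6)"
    using k(3) unfolding B_def[symmetric] AB[symmetric] by (simp add: algebra_simps)
  then have "5 * A < B\<^sup>2 + 2 * B + 6" using assms(1) by (simp only: mult_less_cancel_left_pos)
  moreover have "B \<ge> 0" using k(1) unfolding B_def .
  ultimately obtain w x y z :: nat where "3 * (int w)\<^sup>2 + (int x)\<^sup>2 + (int y)\<^sup>2 + (int z)\<^sup>2 = A"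
    "3 * int w + int x + int y + int z = B"
    using weighted_four_squares by blast
  then have "3 * int w * (a * int w + b) + int x * (a * int x + b) + int y * (a * int y + b)
      + int z * (a * int z + b) = a * A + b * B"
    by (auto simp: power2_eq_square algebra_simps)
  then show ?thesis unfolding AB by blast
qed

end
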